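(* Let $H=\{H_\alpha\}_{\alpha\in\pi}$ be a Hopf $\pi$-coalgebra with $\dim H_\alpha<\infty$ for all $\alpha\in\pi$, let $(C,\sigma)$ be a left $\pi$-coisotropic quantum subgroup of $H$, and let $V=\{V_\alpha\}_{\alpha\in\pi}$ be a left $\pi$-comodule over $C$ with coaction $\rho=\{\rho_{\alpha,\beta}:V_{\alpha\beta}\to C_\alpha\otimes V_\beta\}$. For $\alpha\in\pi$ put $$W_\alpha=\{F\in Hom_K(V_1,H_\alpha):\ L_{1,\alpha}F=(I_{C_1}\otimes F)\rho_{1,1}\},\qquad L_{1,\alpha}=(\sigma_1\otimes I_{H_\alpha})\Delta^H_{1,\alpha}.$$ For each $\beta\in\pi$ let $\{e_i^\beta\}_{i}$ and $\{g_i^\beta\}_{i}$ be dual bases of $H_\beta$ and $H_\beta^*$. Then $W=\{W_\alpha\}_{\alpha\in\pi}$ is a right $\pi$-comodule over $H$ with coaction $\Omega=\{\Omega_{\alpha,\beta}\}_{\alpha,\beta\in\pi}$, where $$\Omega_{\alpha,\beta}:W_{\alpha\beta}\to W_\alpha\otimes H_\beta,\qquad \Omega_{\alpha,\beta}(F)=\sum_i \big[(I_{H_\alpha}\otimes g_i^\beta)\Delta^H_{\alpha,\beta}F\big]\otimes e_i^\beta,$$ and $H_\alpha\otimes K$ is identified with $H_\alpha$.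
   Context: Everything is over a field $K$: spaces, linear maps, tensor products; algebras are associative and unital. $I$ denotes identity maps. $\pi$ is a group with neutral element $1$. A $\pi$-coalgebra is a family $C=\{C_\alpha\}_{\alpha\in\pi}$ of $K$-spaces with linear maps $\Delta_{\alpha,\beta}:C_{\alpha\beta}\to C_\alpha\otimes C_\beta$ and $\epsilon:C_1\to K$ such that $(\Delta_{\alpha,\beta}\otimes I)\Delta_{\alpha\beta,\gamma}=(I\otimes\Delta_{\beta,\gamma})\Delta_{\alpha,\beta\gamma}$ and $(\epsilon\otimes I)\Delta_{1,\alpha}=I=(I\otimes\epsilon)\Delta_{\alpha,1}$ (identifying $K\otimes C_\alpha\cong C_\alpha\cong C_\alpha\otimes K$). A Hopf $\pi$-coalgebra is a $\pi$-coalgebra $H=\{H_\alpha\}$ with linear maps $S_\alpha:H_\alpha\to H_{\alpha^{-1}}$ such that each $H_\alpha$ is an algebra (multiplication $\mu_\alpha$, unit $1_\alpha$), all $\Delta_{\alpha,\beta}$ and $\epsilon$ are algebra maps, and $\mu_\alpha(S_{\alpha^{-1}}\otimes I)\Delta_{\alpha^{-1},\alpha}=1_\alpha\epsilon=\mu_\alpha(I\otimes S_{\alpha^{-1}})\Delta_{\alpha,\alpha^{-1}}$. A right $\pi$-comodule over a $\pi$-coalgebra $C$ is a family $M=\{M_\alpha\}$ of spaces with linear maps $\theta_{\alpha,\beta}:M_{\alpha\beta}\to M_\alpha\otimes C_\beta$ such that $(\theta_{\alpha,\beta}\otimes I)\theta_{\alpha\beta,\gamma}=(I\otimes\Delta_{\beta,\gamma})\theta_{\alpha,\beta\gamma}$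 and $(I\otimes\epsilon)\theta_{\alpha,1}=I$. A left $\pi$-comodule over $C$ is a family $V=\{V_\alpha\}$ with linear maps $\rho_{\alpha,\beta}:V_{\alpha\beta}\to C_\alpha\otimes V_\beta$ such that $(\Delta_{\alpha,\beta}\otimes I)\rho_{\alpha\beta,\gamma}=(I\otimes\rho_{\beta,\gamma})\rho_{\alpha,\beta\gamma}$ and $(\epsilon\otimes I)\rho_{1,\alpha}=I$. (Canonical identifications with tensoring by $K$ are used.) A left $\pi$-coisotropic quantum subgroup of $H$ is a pair $(C,\sigma)$ where $C$ is a $\pi$-coalgebra, each $C_\alpha$ carries a left $H_\alpha$-module structure, and $\sigma=\{\sigma_\alpha:H_\alpha\to C_\alpha\}$ is a family of surjective linear maps such that each $\sigma_\alpha$ is left $H_\alpha$-linear, $\Delta^C_{\alpha,\beta}\sigma_{\alpha\beta}=(\sigma_\alpha\otimes\sigma_\beta)\Delta^H_{\alpha,\beta}$ for all $\alpha,\beta$, and $\epsilon^C\sigma_1=\epsilon^H$. *)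

theory Defs
  imports "HOL-Algebra.Module" "HOL-Algebra.AbelCoset" "HOL-Algebra.RingHom"
begin

text \<open>
  A \<open>K\<close>-space is a HOL-Algebra module \<open>module K M\<close> over a field \<open>K\<close>; the record fields
  \<open>mult\<close> and \<open>one\<close> of \<open>M\<close> are irrelevant unless \<open>M\<close> is an algebra. Maps between spaces are
  only constrained on the carriers, and all identities of maps are stated pointwise on carriers.
\<close>

section \<open>Linear maps\<close>

definition linear_maps :: "'k ring \<Rightarrow> ('k, 'a) module \<Rightarrow> ('k, 'b) module \<Rightarrow> ('a \<Rightarrow> 'b) set" where
  "linear_maps K M N = {f \<in> carrier M \<rightarrow> carrier N.
     (\<forall>x\<in>carrier M. \<forall>y\<in>carrier M. f (x \<oplus>\<^bsub>M\<^esub> y) = f x \<oplus>\<^bsub>N\<^esub> f y) \<and>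
     (\<forall>k\<in>carrier K. \<forall>x\<in>carrier M. f (k \<odot>\<^bsub>M\<^esub> x) = k \<odot>\<^bsub>N\<^esub> f x)}"

definition base_space :: "'k ring \<Rightarrow> ('k, 'k) module" where
  "base_space K = \<lparr>carrier = carrier K, mult = mult K, one = one K,
     zero = zero K, add = add K, smult = mult K\<rparr>"

text \<open>Extensionality makes equality in \<open>Hom\<close> the equality of maps on \<open>carrier M\<close>.\<close>

definition Hom_space :: "'k ring \<Rightarrow> ('k, 'a) module \<Rightarrow> ('k, 'b) module \<Rightarrow> ('k, 'a \<Rightarrow> 'b) module" where
  "Hom_space K M N = \<lparr>carrier = linear_maps K M N \<inter> extensional (carrier M),
     mult = undefined, one = undefined,
     zero = (\<lambda>x\<in>carrier M. \<zero>\<^bsub>N\<^esub>),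
     add = (\<lambda>f g. \<lambda>x\<in>carrier M. f x \<oplus>\<^bsub>N\<^esub> g x),
     smult = (\<lambda>k f. \<lambda>x\<in>carrier M. k \<odot>\<^bsub>N\<^esub> f x)\<rparr>"

definition bilinear_map ::
  "'k ring \<Rightarrow> ('k, 'a) module \<Rightarrow> ('k, 'b) module \<Rightarrow> ('k, 'p) module \<Rightarrow> ('a \<Rightarrow> 'b \<Rightarrow> 'p) \<Rightarrow> bool" where
  "bilinear_map K A B P f \<longleftrightarrow>
     (\<forall>a\<in>carrier A. f a \<in> linear_maps K B P) \<and>
     (\<forall>b\<in>carrier B. (\<lambda>a. f a b) \<in> linear_maps K A P)"

definition is_basis :: "'k ring \<Rightarrow> ('k, 'a) module \<Rightarrow> 'i set \<Rightarrow> ('i \<Rightarrow> 'a) \<Rightarrow> bool" where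
  "is_basis K M I e \<longleftrightarrow> finite I \<and> e \<in> I \<rightarrow> carrier M \<and>
     (\<forall>x\<in>carrier M. \<exists>!c. c \<in> I \<rightarrow>\<^sub>E carrier K \<and> x = (\<Oplus>\<^bsub>M\<^esub>i\<in>I. c i \<odot>\<^bsub>M\<^esub> e i))"

definition fin_dim :: "'k ring \<Rightarrow> ('k, 'a) module \<Rightarrow> bool" where
  "fin_dim K M \<longleftrightarrow> (\<exists>B. finite B \<and> B \<subseteq> carrier M \<and>
     (\<forall>x\<in>carrier M. \<exists>c \<in> B \<rightarrow> carrier K. x = (\<Oplus>\<^bsub>M\<^esub>b\<in>B. c b \<odot>\<^bsub>M\<^esub> b)))"

definition dual_bases ::
  "'k ring \<Rightarrow> ('k, 'a) module \<Rightarrow> 'i set \<Rightarrow> ('i \<Rightarrow> 'a) \<Rightarrow> ('i \<Rightarrow> 'a \<Rightarrow> 'k) \<Rightarrow> bool" where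
  "dual_bases K M I e g \<longleftrightarrow> is_basis K M I e \<and> is_basis K (Hom_space K M (base_space K)) I g \<and>
     (\<forall>i\<in>I. \<forall>j\<in>I. g i (e j) = (if i = j then \<one>\<^bsub>K\<^esub> else \<zero>\<^bsub>K\<^esub>))"

section \<open>Tensor products\<close>

text \<open>
  \<open>A \<otimes> B\<close> is the free space on \<open>carrier A \<times> carrier B\<close> modulo the subspace generated by the
  bilinearity relations.
\<close>

definition free_space :: "'k ring \<Rightarrow> 's set \<Rightarrow> ('k, 's \<Rightarrow> 'k) module" where
  "free_space K S = \<lparr>carrier = {\<phi>. range \<phi> \<subseteq> carrier K \<and> finite {s. \<phi> s \<noteq> \<zero>\<^bsub>K\<^esub>} \<and> {s. \<phi> s \<noteq> \<zero>\<^bsub>K\<^esub>} \<subseteq> S},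
     mult = undefined, one = undefined,
     zero = (\<lambda>_. \<zero>\<^bsub>K\<^esub>), add = (\<lambda>\<phi> \<psi> s. \<phi> s \<oplus>\<^bsub>K\<^esub> \<psi> s), smult = (\<lambda>k \<phi> s. k \<otimes>\<^bsub>K\<^esub> \<phi> s)\<rparr>"

definition free_gen :: "'k ring \<Rightarrow> 's \<Rightarrow> 's \<Rightarrow> 'k" where
  "free_gen K s = (\<lambda>t. if t = s then \<one>\<^bsub>K\<^esub> else \<zero>\<^bsub>K\<^esub>)"

definition quotient_space :: "('k, 'a) module \<Rightarrow> 'a set \<Rightarrow> ('k, 'a set) module" where
  "quotient_space F N = \<lparr>carrier = a_rcosets\<^bsub>F\<^esub> N, mult = undefined, one = undefined,
     zero = N, add = set_add F, smult = (\<lambda>k X. \<Union>x\<in>X. N +>\<^bsub>F\<^esub> (k \<odot>\<^bsub>F\<^esub> x))\<rparr>"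

definition tensor_relations ::
  "'k ring \<Rightarrow> ('k, 'a) module \<Rightarrow> ('k, 'b) module \<Rightarrow> ('a \<times> 'b \<Rightarrow> 'k) set" where
  "tensor_relations K A B =
    (let F = free_space K (carrier A \<times> carrier B); \<gamma> = (\<lambda>a b. free_gen K (a, b)) in
     {\<gamma> (a \<oplus>\<^bsub>A\<^esub> a') b \<ominus>\<^bsub>F\<^esub> (\<gamma> a b \<oplus>\<^bsub>F\<^esub> \<gamma> a' b) |a a' b. a \<in> carrier A \<and> a' \<in> carrier A \<and> b \<in> carrier B} \<union>
     {\<gamma> a (b \<oplus>\<^bsub>B\<^esub> b') \<ominus>\<^bsub>F\<^esub> (\<gamma> a b \<oplus>\<^bsub>F\<^esub> \<gamma> a b') |a b b'. a \<in> carrier A \<and> b \<in> carrier B \<and> b' \<in> carrier B} \<union>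
     {\<gamma> (k \<odot>\<^bsub>A\<^esub> a) b \<ominus>\<^bsub>F\<^esub> k \<odot>\<^bsub>F\<^esub> \<gamma> a b |k a b. k \<in> carrier K \<and> a \<in> carrier A \<and> b \<in> carrier B} \<union>
     {\<gamma> a (k \<odot>\<^bsub>B\<^esub> b) \<ominus>\<^bsub>F\<^esub> k \<odot>\<^bsub>F\<^esub> \<gamma> a b |k a b. k \<in> carrier K \<and> a \<in> carrier A \<and> b \<in> carrier B})"

definition tensor_null ::
  "'k ring \<Rightarrow> ('k, 'a) module \<Rightarrow> ('k, 'b) module \<Rightarrow> ('a \<times> 'b \<Rightarrow> 'k) set" where
  "tensor_null K A B =
     \<Inter>{N. submodule N K (free_space K (carrier A \<times> carrier B)) \<and> tensor_relations K A B \<subseteq> N}"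

definition tensor ::
  "'k ring \<Rightarrow> ('k, 'a) module \<Rightarrow> ('k, 'b) module \<Rightarrow> ('k, ('a \<times> 'b \<Rightarrow> 'k) set) module" where
  "tensor K A B = quotient_space (free_space K (carrier A \<times> carrier B)) (tensor_null K A B)"

definition pure_tensor ::
  "'k ring \<Rightarrow> ('k, 'a) module \<Rightarrow> ('k, 'b) module \<Rightarrow> 'a \<Rightarrow> 'b \<Rightarrow> ('a \<times> 'b \<Rightarrow> 'k) set" where
  "pure_tensor K A B a b =
     tensor_null K A B +>\<^bsub>free_space K (carrier A \<times> carrier B)\<^esub> free_gen K (a, b)"

text \<open>
  The linear map \<open>A \<otimes> B \<rightarrow> P\<close> induced by a bilinear map; it exists and is unique by
  \<open>tensor_universal\<close> below.
\<close>

definition tensor_lift ::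
  "'k ring \<Rightarrow> ('k, 'a) module \<Rightarrow> ('k, 'b) module \<Rightarrow> ('k, 'p) module \<Rightarrow> ('a \<Rightarrow> 'b \<Rightarrow> 'p)
    \<Rightarrow> ('a \<times> 'b \<Rightarrow> 'k) set \<Rightarrow> 'p" where
  "tensor_lift K A B P f = (THE h. h \<in> carrier (Hom_space K (tensor K A B) P) \<and>
     (\<forall>a\<in>carrier A. \<forall>b\<in>carrier B. h (pure_tensor K A B a b) = f a b))"

text \<open>\<open>tensor_map K A B A' B' f g\<close> is \<open>f \<otimes> g : A \<otimes> B \<rightarrow> A' \<otimes> B'\<close>.\<close>

definition tensor_map ::
  "'k ring \<Rightarrow> ('k, 'a) module \<Rightarrow> ('k, 'b) module \<Rightarrow> ('k, 'c) module \<Rightarrow> ('k, 'd) module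
    \<Rightarrow> ('a \<Rightarrow> 'c) \<Rightarrow> ('b \<Rightarrow> 'd) \<Rightarrow> ('a \<times> 'b \<Rightarrow> 'k) set \<Rightarrow> ('c \<times> 'd \<Rightarrow> 'k) set" where
  "tensor_map K A B A' B' f g =
     tensor_lift K A B (tensor K A' B') (\<lambda>a b. pure_tensor K A' B' (f a) (g b))"

text \<open>The canonical identifications
  \<open>(A \<otimes> B) \<otimes> C \<cong> A \<otimes> (B \<otimes> C)\<close>, \<open>K \<otimes> A \<cong> A\<close> and \<open>A \<otimes> K \<cong> A\<close>.\<close>

definition tensor_assoc ::
  "'k ring \<Rightarrow> ('k, 'a) module \<Rightarrow> ('k, 'b) module \<Rightarrow> ('k, 'c) module
    \<Rightarrow> (('a \<times> 'b \<Rightarrow> 'k) set \<times> 'c \<Rightarrow> 'k) set \<Rightarrow> ('a \<times> ('b \<times> 'c \<Rightarrow> 'k) set \<Rightarrow> 'k) set" where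
  "tensor_assoc K A B C =
     tensor_lift K (tensor K A B) C (tensor K A (tensor K B C))
       (\<lambda>t c. tensor_lift K A B (tensor K A (tensor K B C))
         (\<lambda>a b. pure_tensor K A (tensor K B C) a (pure_tensor K B C b c)) t)"

definition tensor_lunit :: "'k ring \<Rightarrow> ('k, 'a) module \<Rightarrow> ('k \<times> 'a \<Rightarrow> 'k) set \<Rightarrow> 'a" where
  "tensor_lunit K A = tensor_lift K (base_space K) A A (\<lambda>k a. k \<odot>\<^bsub>A\<^esub> a)"

definition tensor_runit :: "'k ring \<Rightarrow> ('k, 'a) module \<Rightarrow> ('a \<times> 'k \<Rightarrow> 'k) set \<Rightarrow> 'a" where
  "tensor_runit K A = tensor_lift K A (base_space K) A (\<lambda>a k. k \<odot>\<^bsub>A\<^esub> a)"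

section \<open>Algebras\<close>

definition K_algebra :: "'k ring \<Rightarrow> ('k, 'a) module \<Rightarrow> bool" where
  "K_algebra K A \<longleftrightarrow> module K A \<and> ring A \<and>
     (\<forall>k\<in>carrier K. \<forall>x\<in>carrier A. \<forall>y\<in>carrier A.
        (k \<odot>\<^bsub>A\<^esub> x) \<otimes>\<^bsub>A\<^esub> y = k \<odot>\<^bsub>A\<^esub> (x \<otimes>\<^bsub>A\<^esub> y) \<and> x \<otimes>\<^bsub>A\<^esub> (k \<odot>\<^bsub>A\<^esub> y) = k \<odot>\<^bsub>A\<^esub> (x \<otimes>\<^bsub>A\<^esub> y))"

definition algebra_maps :: "'k ring \<Rightarrow> ('k, 'a) module \<Rightarrow> ('k, 'b) module \<Rightarrow> ('a \<Rightarrow> 'b) set" where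
  "algebra_maps K A B = linear_maps K A B \<inter> ring_hom A B"

text \<open>\<open>A \<otimes> B\<close> with \<open>(a \<otimes> b) (a' \<otimes> b') = a a' \<otimes> b b'\<close>.\<close>

definition tensor_algebra ::
  "'k ring \<Rightarrow> ('k, 'a) module \<Rightarrow> ('k, 'b) module \<Rightarrow> ('k, ('a \<times> 'b \<Rightarrow> 'k) set) module" where
  "tensor_algebra K A B = (tensor K A B)\<lparr>
     mult := (\<lambda>s t. tensor_lift K A B (tensor K A B)
       (\<lambda>a b. tensor_lift K A B (tensor K A B)
         (\<lambda>a' b'. pure_tensor K A B (a \<otimes>\<^bsub>A\<^esub> a') (b \<otimes>\<^bsub>B\<^esub> b')) t) s),
     one := pure_tensor K A B \<one>\<^bsub>A\<^esub> \<one>\<^bsub>B\<^esub>\<rparr>"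

definition mult_map :: "'k ring \<Rightarrow> ('k, 'a) module \<Rightarrow> ('a \<times> 'a \<Rightarrow> 'k) set \<Rightarrow> 'a" where
  "mult_map K A = tensor_lift K A A A (mult A)"

definition left_algebra_module ::
  "'k ring \<Rightarrow> ('k, 'a) module \<Rightarrow> ('k, 'm) module \<Rightarrow> ('a \<Rightarrow> 'm \<Rightarrow> 'm) \<Rightarrow> bool" where
  "left_algebra_module K A M act \<longleftrightarrow> module K M \<and> bilinear_map K A M M act \<and>
     (\<forall>x\<in>carrier A. \<forall>y\<in>carrier A. \<forall>m\<in>carrier M. act (x \<otimes>\<^bsub>A\<^esub> y) m = act x (act y m)) \<and>
     (\<forall>m\<in>carrier M. act \<one>\<^bsub>A\<^esub> m = m)"

section \<open>Group-indexed coalgebras and comodules\<close>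

locale pi_coalgebra =
  fixes K :: "'k ring" and \<pi> :: "'g monoid" and C :: "'g \<Rightarrow> ('k, 'c) module"
    and \<Delta> :: "'g \<Rightarrow> 'g \<Rightarrow> 'c \<Rightarrow> ('c \<times> 'c \<Rightarrow> 'k) set" and \<epsilon> :: "'c \<Rightarrow> 'k"
  assumes field_K: "field K" and group_pi: "group \<pi>"
    and space: "\<alpha> \<in> carrier \<pi> \<Longrightarrow> module K (C \<alpha>)"
    and comult_linear: "\<lbrakk>\<alpha> \<in> carrier \<pi>; \<beta> \<in> carrier \<pi>\<rbrakk> \<Longrightarrow>
      \<Delta> \<alpha> \<beta> \<in> linear_maps K (C (\<alpha> \<otimes>\<^bsub>\<pi>\<^esub> \<beta>)) (tensor K (C \<alpha>) (C \<beta>))"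
    and counit_linear: "\<epsilon> \<in> linear_maps K (C \<one>\<^bsub>\<pi>\<^esub>) (base_space K)"
    and coassoc: "\<lbrakk>\<alpha> \<in> carrier \<pi>; \<beta> \<in> carrier \<pi>; \<gamma> \<in> carrier \<pi>;
        x \<in> carrier (C (\<alpha> \<otimes>\<^bsub>\<pi>\<^esub> \<beta> \<otimes>\<^bsub>\<pi>\<^esub> \<gamma>))\<rbrakk> \<Longrightarrow>
      tensor_assoc K (C \<alpha>) (C \<beta>) (C \<gamma>)
        (tensor_map K (C (\<alpha> \<otimes>\<^bsub>\<pi>\<^esub> \<beta>)) (C \<gamma>) (tensor K (C \<alpha>) (C \<beta>)) (C \<gamma>)
          (\<Delta> \<alpha> \<beta>) (\<lambda>y. y) (\<Delta> (\<alpha> \<otimes>\<^bsub>\<pi>\<^esub> \<beta>) \<gamma> x)) =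
      tensor_map K (C \<alpha>) (C (\<beta> \<otimes>\<^bsub>\<pi>\<^esub> \<gamma>)) (C \<alpha>) (tensor K (C \<beta>) (C \<gamma>))
        (\<lambda>y. y) (\<Delta> \<beta> \<gamma>) (\<Delta> \<alpha> (\<beta> \<otimes>\<^bsub>\<pi>\<^esub> \<gamma>) x)"
    and counit_left: "\<lbrakk>\<alpha> \<in> carrier \<pi>; x \<in> carrier (C \<alpha>)\<rbrakk> \<Longrightarrow>
      tensor_lunit K (C \<alpha>)
        (tensor_map K (C \<one>\<^bsub>\<pi>\<^esub>) (C \<alpha>) (base_space K) (C \<alpha>) \<epsilon> (\<lambda>y. y) (\<Delta> \<one>\<^bsub>\<pi>\<^esub> \<alpha> x)) = x"
    and counit_right: "\<lbrakk>\<alpha> \<in> carrier \<pi>; x \<in> carrier (C \<alpha>)\<rbrakk> \<Longrightarrow>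
      tensor_runit K (C \<alpha>)
        (tensor_map K (C \<alpha>) (C \<one>\<^bsub>\<pi>\<^esub>) (C \<alpha>) (base_space K) (\<lambda>y. y) \<epsilon> (\<Delta> \<alpha> \<one>\<^bsub>\<pi>\<^esub> x)) = x"

locale hopf_pi_coalgebra = pi_coalgebra K \<pi> H \<Delta> \<epsilon>
  for K :: "'k ring" and \<pi> :: "'g monoid" and H :: "'g \<Rightarrow> ('k, 'h) module"
    and \<Delta> :: "'g \<Rightarrow> 'g \<Rightarrow> 'h \<Rightarrow> ('h \<times> 'h \<Rightarrow> 'k) set" and \<epsilon> :: "'h \<Rightarrow> 'k" +
  fixes S :: "'g \<Rightarrow> 'h \<Rightarrow> 'h"
  assumes algebra: "\<alpha> \<in> carrier \<pi> \<Longrightarrow> K_algebra K (H \<alpha>)"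
    and comult_algebra_map: "\<lbrakk>\<alpha> \<in> carrier \<pi>; \<beta> \<in> carrier \<pi>\<rbrakk> \<Longrightarrow>
      \<Delta> \<alpha> \<beta> \<in> algebra_maps K (H (\<alpha> \<otimes>\<^bsub>\<pi>\<^esub> \<beta>)) (tensor_algebra K (H \<alpha>) (H \<beta>))"
    and counit_algebra_map: "\<epsilon> \<in> algebra_maps K (H \<one>\<^bsub>\<pi>\<^esub>) (base_space K)"
    and antipode_linear: "\<alpha> \<in> carrier \<pi> \<Longrightarrow> S \<alpha> \<in> linear_maps K (H \<alpha>) (H (inv\<^bsub>\<pi>\<^esub> \<alpha>))"
    and antipode_left: "\<lbrakk>\<alpha> \<in> carrier \<pi>; x \<in> carrier (H \<one>\<^bsub>\<pi>\<^esub>)\<rbrakk> \<Longrightarrow>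
      mult_map K (H \<alpha>)
        (tensor_map K (H (inv\<^bsub>\<pi>\<^esub> \<alpha>)) (H \<alpha>) (H \<alpha>) (H \<alpha>)
          (S (inv\<^bsub>\<pi>\<^esub> \<alpha>)) (\<lambda>y. y) (\<Delta> (inv\<^bsub>\<pi>\<^esub> \<alpha>) \<alpha> x)) = \<epsilon> x \<odot>\<^bsub>H \<alpha>\<^esub> \<one>\<^bsub>H \<alpha>\<^esub>"
    and antipode_right: "\<lbrakk>\<alpha> \<in> carrier \<pi>; x \<in> carrier (H \<one>\<^bsub>\<pi>\<^esub>)\<rbrakk> \<Longrightarrow>
      mult_map K (H \<alpha>)
        (tensor_map K (H \<alpha>) (H (inv\<^bsub>\<pi>\<^esub> \<alpha>)) (H \<alpha>) (H \<alpha>)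
          (\<lambda>y. y) (S (inv\<^bsub>\<pi>\<^esub> \<alpha>)) (\<Delta> \<alpha> (inv\<^bsub>\<pi>\<^esub> \<alpha>) x)) = \<epsilon> x \<odot>\<^bsub>H \<alpha>\<^esub> \<one>\<^bsub>H \<alpha>\<^esub>"

locale right_pi_comodule = pi_coalgebra K \<pi> C \<Delta> \<epsilon>
  for K :: "'k ring" and \<pi> :: "'g monoid" and C :: "'g \<Rightarrow> ('k, 'c) module"
    and \<Delta> :: "'g \<Rightarrow> 'g \<Rightarrow> 'c \<Rightarrow> ('c \<times> 'c \<Rightarrow> 'k) set" and \<epsilon> :: "'c \<Rightarrow> 'k" +
  fixes M :: "'g \<Rightarrow> ('k, 'm) module" and \<theta> :: "'g \<Rightarrow> 'g \<Rightarrow> 'm \<Rightarrow> ('m \<times> 'c \<Rightarrow> 'k) set"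
  assumes comodule_space: "\<alpha> \<in> carrier \<pi> \<Longrightarrow> module K (M \<alpha>)"
    and coaction_linear: "\<lbrakk>\<alpha> \<in> carrier \<pi>; \<beta> \<in> carrier \<pi>\<rbrakk> \<Longrightarrow>
      \<theta> \<alpha> \<beta> \<in> linear_maps K (M (\<alpha> \<otimes>\<^bsub>\<pi>\<^esub> \<beta>)) (tensor K (M \<alpha>) (C \<beta>))"
    and coaction_coassoc: "\<lbrakk>\<alpha> \<in> carrier \<pi>; \<beta> \<in> carrier \<pi>; \<gamma> \<in> carrier \<pi>;
        x \<in> carrier (M (\<alpha> \<otimes>\<^bsub>\<pi>\<^esub> \<beta> \<otimes>\<^bsub>\<pi>\<^esub> \<gamma>))\<rbrakk> \<Longrightarrow>
      tensor_assoc K (M \<alpha>) (C \<beta>) (C \<gamma>)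
        (tensor_map K (M (\<alpha> \<otimes>\<^bsub>\<pi>\<^esub> \<beta>)) (C \<gamma>) (tensor K (M \<alpha>) (C \<beta>)) (C \<gamma>)
          (\<theta> \<alpha> \<beta>) (\<lambda>y. y) (\<theta> (\<alpha> \<otimes>\<^bsub>\<pi>\<^esub> \<beta>) \<gamma> x)) =
      tensor_map K (M \<alpha>) (C (\<beta> \<otimes>\<^bsub>\<pi>\<^esub> \<gamma>)) (M \<alpha>) (tensor K (C \<beta>) (C \<gamma>))
        (\<lambda>y. y) (\<Delta> \<beta> \<gamma>) (\<theta> \<alpha> (\<beta> \<otimes>\<^bsub>\<pi>\<^esub> \<gamma>) x)"
    and coaction_counit: "\<lbrakk>\<alpha> \<in> carrier \<pi>; x \<in> carrier (M \<alpha>)\<rbrakk> \<Longrightarrow>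
      tensor_runit K (M \<alpha>)
        (tensor_map K (M \<alpha>) (C \<one>\<^bsub>\<pi>\<^esub>) (M \<alpha>) (base_space K) (\<lambda>y. y) \<epsilon> (\<theta> \<alpha> \<one>\<^bsub>\<pi>\<^esub> x)) = x"

locale left_pi_comodule = pi_coalgebra K \<pi> C \<Delta> \<epsilon>
  for K :: "'k ring" and \<pi> :: "'g monoid" and C :: "'g \<Rightarrow> ('k, 'c) module"
    and \<Delta> :: "'g \<Rightarrow> 'g \<Rightarrow> 'c \<Rightarrow> ('c \<times> 'c \<Rightarrow> 'k) set" and \<epsilon> :: "'c \<Rightarrow> 'k" +
  fixes V :: "'g \<Rightarrow> ('k, 'v) module" and \<rho> :: "'g \<Rightarrow> 'g \<Rightarrow> 'v \<Rightarrow> ('c \<times> 'v \<Rightarrow> 'k) set"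
  assumes comodule_space: "\<alpha> \<in> carrier \<pi> \<Longrightarrow> module K (V \<alpha>)"
    and coaction_linear: "\<lbrakk>\<alpha> \<in> carrier \<pi>; \<beta> \<in> carrier \<pi>\<rbrakk> \<Longrightarrow>
      \<rho> \<alpha> \<beta> \<in> linear_maps K (V (\<alpha> \<otimes>\<^bsub>\<pi>\<^esub> \<beta>)) (tensor K (C \<alpha>) (V \<beta>))"
    and coaction_coassoc: "\<lbrakk>\<alpha> \<in> carrier \<pi>; \<beta> \<in> carrier \<pi>; \<gamma> \<in> carrier \<pi>;
        x \<in> carrier (V (\<alpha> \<otimes>\<^bsub>\<pi>\<^esub> \<beta> \<otimes>\<^bsub>\<pi>\<^esub> \<gamma>))\<rbrakk> \<Longrightarrow>
      tensor_assoc K (C \<alpha>) (C \<beta>) (V \<gamma>)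
        (tensor_map K (C (\<alpha> \<otimes>\<^bsub>\<pi>\<^esub> \<beta>)) (V \<gamma>) (tensor K (C \<alpha>) (C \<beta>)) (V \<gamma>)
          (\<Delta> \<alpha> \<beta>) (\<lambda>y. y) (\<rho> (\<alpha> \<otimes>\<^bsub>\<pi>\<^esub> \<beta>) \<gamma> x)) =
      tensor_map K (C \<alpha>) (V (\<beta> \<otimes>\<^bsub>\<pi>\<^esub> \<gamma>)) (C \<alpha>) (tensor K (C \<beta>) (V \<gamma>))
        (\<lambda>y. y) (\<rho> \<beta> \<gamma>) (\<rho> \<alpha> (\<beta> \<otimes>\<^bsub>\<pi>\<^esub> \<gamma>) x)"
    and coaction_counit: "\<lbrakk>\<alpha> \<in> carrier \<pi>; x \<in> carrier (V \<alpha>)\<rbrakk> \<Longrightarrow>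
      tensor_lunit K (V \<alpha>)
        (tensor_map K (C \<one>\<^bsub>\<pi>\<^esub>) (V \<alpha>) (base_space K) (V \<alpha>) \<epsilon> (\<lambda>y. y) (\<rho> \<one>\<^bsub>\<pi>\<^esub> \<alpha> x)) = x"

text \<open>\<open>act \<alpha>\<close> is the left \<open>H \<alpha>\<close>-module structure on \<open>C \<alpha>\<close>.\<close>

locale left_pi_coisotropic_quantum_subgroup =
  H: hopf_pi_coalgebra K \<pi> H \<Delta>\<^sub>H \<epsilon>\<^sub>H S + C: pi_coalgebra K \<pi> C \<Delta>\<^sub>C \<epsilon>\<^sub>C
  for K :: "'k ring" and \<pi> :: "'g monoid" and H :: "'g \<Rightarrow> ('k, 'h) module"
    and \<Delta>\<^sub>H :: "'g \<Rightarrow> 'g \<Rightarrow> 'h \<Rightarrow> ('h \<times> 'h \<Rightarrow> 'k) set" and \<epsilon>\<^sub>H :: "'h \<Rightarrow> 'k"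
    and S :: "'g \<Rightarrow> 'h \<Rightarrow> 'h"
    and C :: "'g \<Rightarrow> ('k, 'c) module"
    and \<Delta>\<^sub>C :: "'g \<Rightarrow> 'g \<Rightarrow> 'c \<Rightarrow> ('c \<times> 'c \<Rightarrow> 'k) set" and \<epsilon>\<^sub>C :: "'c \<Rightarrow> 'k" +
  fixes act :: "'g \<Rightarrow> 'h \<Rightarrow> 'c \<Rightarrow> 'c" and \<sigma> :: "'g \<Rightarrow> 'h \<Rightarrow> 'c"
  assumes module_structure: "\<alpha> \<in> carrier \<pi> \<Longrightarrow> left_algebra_module K (H \<alpha>) (C \<alpha>) (act \<alpha>)"
    and sigma_linear: "\<alpha> \<in> carrier \<pi> \<Longrightarrow> \<sigma> \<alpha> \<in> linear_maps K (H \<alpha>) (C \<alpha>)"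
    and sigma_surj: "\<alpha> \<in> carrier \<pi> \<Longrightarrow> \<sigma> \<alpha> ` carrier (H \<alpha>) = carrier (C \<alpha>)"
    and sigma_H_linear: "\<lbrakk>\<alpha> \<in> carrier \<pi>; x \<in> carrier (H \<alpha>); y \<in> carrier (H \<alpha>)\<rbrakk> \<Longrightarrow>
      \<sigma> \<alpha> (x \<otimes>\<^bsub>H \<alpha>\<^esub> y) = act \<alpha> x (\<sigma> \<alpha> y)"
    and sigma_comult: "\<lbrakk>\<alpha> \<in> carrier \<pi>; \<beta> \<in> carrier \<pi>; x \<in> carrier (H (\<alpha> \<otimes>\<^bsub>\<pi>\<^esub> \<beta>))\<rbrakk> \<Longrightarrow>
      \<Delta>\<^sub>C \<alpha> \<beta> (\<sigma> (\<alpha> \<otimes>\<^bsub>\<pi>\<^esub> \<beta>) x) =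
      tensor_map K (H \<alpha>) (H \<beta>) (C \<alpha>) (C \<beta>) (\<sigma> \<alpha>) (\<sigma> \<beta>) (\<Delta>\<^sub>H \<alpha> \<beta> x)"
    and sigma_counit: "x \<in> carrier (H \<one>\<^bsub>\<pi>\<^esub>) \<Longrightarrow> \<epsilon>\<^sub>C (\<sigma> \<one>\<^bsub>\<pi>\<^esub> x) = \<epsilon>\<^sub>H x"

section \<open>The induced comodule\<close>

definition induced_L ::
  "'k ring \<Rightarrow> 'g monoid \<Rightarrow> ('g \<Rightarrow> ('k, 'h) module) \<Rightarrow> ('g \<Rightarrow> 'g \<Rightarrow> 'h \<Rightarrow> ('h \<times> 'h \<Rightarrow> 'k) set)
    \<Rightarrow> ('g \<Rightarrow> ('k, 'c) module) \<Rightarrow> ('g \<Rightarrow> 'h \<Rightarrow> 'c) \<Rightarrow> 'g \<Rightarrow> 'h \<Rightarrow> ('c \<times> 'h \<Rightarrow> 'k) set" where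
  "induced_L K \<pi> H \<Delta> C \<sigma> \<alpha> h =
     tensor_map K (H \<one>\<^bsub>\<pi>\<^esub>) (H \<alpha>) (C \<one>\<^bsub>\<pi>\<^esub>) (H \<alpha>) (\<sigma> \<one>\<^bsub>\<pi>\<^esub>) (\<lambda>y. y) (\<Delta> \<one>\<^bsub>\<pi>\<^esub> \<alpha> h)"

definition induced_W ::
  "'k ring \<Rightarrow> 'g monoid \<Rightarrow> ('g \<Rightarrow> ('k, 'h) module) \<Rightarrow> ('g \<Rightarrow> 'g \<Rightarrow> 'h \<Rightarrow> ('h \<times> 'h \<Rightarrow> 'k) set)
    \<Rightarrow> ('g \<Rightarrow> ('k, 'c) module) \<Rightarrow> ('g \<Rightarrow> 'h \<Rightarrow> 'c)
    \<Rightarrow> ('g \<Rightarrow> ('k, 'v) module) \<Rightarrow> ('g \<Rightarrow> 'g \<Rightarrow> 'v \<Rightarrow> ('c \<times> 'v \<Rightarrow> 'k) set)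
    \<Rightarrow> 'g \<Rightarrow> ('k, 'v \<Rightarrow> 'h) module" where
  "induced_W K \<pi> H \<Delta> C \<sigma> V \<rho> \<alpha> = (Hom_space K (V \<one>\<^bsub>\<pi>\<^esub>) (H \<alpha>))\<lparr>carrier :=
     {F \<in> carrier (Hom_space K (V \<one>\<^bsub>\<pi>\<^esub>) (H \<alpha>)). \<forall>v\<in>carrier (V \<one>\<^bsub>\<pi>\<^esub>).
        induced_L K \<pi> H \<Delta> C \<sigma> \<alpha> (F v) =
        tensor_map K (C \<one>\<^bsub>\<pi>\<^esub>) (V \<one>\<^bsub>\<pi>\<^esub>) (C \<one>\<^bsub>\<pi>\<^esub>) (H \<alpha>) (\<lambda>y. y) F (\<rho> \<one>\<^bsub>\<pi>\<^esub> \<one>\<^bsub>\<pi>\<^esub> v)}\<rparr>"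

text \<open>\<open>induced_slice K \<pi> H \<Delta> V \<alpha> \<beta> g F\<close> is \<open>(I \<otimes> g) \<Delta>\<^bsub>\<alpha>,\<beta>\<^esub> F\<close>, after \<open>H \<alpha> \<otimes> K \<cong> H \<alpha>\<close>, for \<open>g : H \<beta> \<rightarrow> K\<close>.\<close>

definition induced_slice ::
  "'k ring \<Rightarrow> 'g monoid \<Rightarrow> ('g \<Rightarrow> ('k, 'h) module) \<Rightarrow> ('g \<Rightarrow> 'g \<Rightarrow> 'h \<Rightarrow> ('h \<times> 'h \<Rightarrow> 'k) set)
    \<Rightarrow> ('g \<Rightarrow> ('k, 'v) module) \<Rightarrow> 'g \<Rightarrow> 'g \<Rightarrow> ('h \<Rightarrow> 'k) \<Rightarrow> ('v \<Rightarrow> 'h) \<Rightarrow> 'v \<Rightarrow> 'h" where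
  "induced_slice K \<pi> H \<Delta> V \<alpha> \<beta> g F = (\<lambda>v\<in>carrier (V \<one>\<^bsub>\<pi>\<^esub>).
     tensor_runit K (H \<alpha>)
       (tensor_map K (H \<alpha>) (H \<beta>) (H \<alpha>) (base_space K) (\<lambda>y. y) g (\<Delta> \<alpha> \<beta> (F v))))"

definition induced_coaction ::
  "'k ring \<Rightarrow> 'g monoid \<Rightarrow> ('g \<Rightarrow> ('k, 'h) module) \<Rightarrow> ('g \<Rightarrow> 'g \<Rightarrow> 'h \<Rightarrow> ('h \<times> 'h \<Rightarrow> 'k) set)
    \<Rightarrow> ('g \<Rightarrow> ('k, 'c) module) \<Rightarrow> ('g \<Rightarrow> 'h \<Rightarrow> 'c)
    \<Rightarrow> ('g \<Rightarrow> ('k, 'v) module) \<Rightarrow> ('g \<Rightarrow> 'g \<Rightarrow> 'v \<Rightarrow> ('c \<times> 'v \<Rightarrow> 'k) set)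
    \<Rightarrow> ('g \<Rightarrow> 'i set) \<Rightarrow> ('g \<Rightarrow> 'i \<Rightarrow> 'h) \<Rightarrow> ('g \<Rightarrow> 'i \<Rightarrow> 'h \<Rightarrow> 'k)
    \<Rightarrow> 'g \<Rightarrow> 'g \<Rightarrow> ('v \<Rightarrow> 'h) \<Rightarrow> (('v \<Rightarrow> 'h) \<times> 'h \<Rightarrow> 'k) set" where
  "induced_coaction K \<pi> H \<Delta> C \<sigma> V \<rho> J e g \<alpha> \<beta> F =
     (let W = induced_W K \<pi> H \<Delta> C \<sigma> V \<rho> \<alpha> in
      \<Oplus>\<^bsub>tensor K W (H \<beta>)\<^esub>i\<in>J \<beta>.
        pure_tensor K W (H \<beta>) (induced_slice K \<pi> H \<Delta> V \<alpha> \<beta> (g \<beta> i) F) (e \<beta> i))"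

section \<open>Existence and uniqueness of \<open>tensor_lift\<close>\<close>

lemma free_space_module:
  assumes "field K"
  shows "module K (free_space K S)"
proof -
  interpret K: field K by fact
  have sub: "{s. f s \<oplus>\<^bsub>K\<^esub> g s \<noteq> \<zero>\<^bsub>K\<^esub>} \<subseteq> {s. f s \<noteq> \<zero>\<^bsub>K\<^esub>} \<union> {s. g s \<noteq> \<zero>\<^bsub>K\<^esub>}"
    for f g :: "'b \<Rightarrow> 'a" by auto
  have sub2: "{s. k \<otimes>\<^bsub>K\<^esub> f s \<noteq> \<zero>\<^bsub>K\<^esub>} \<subseteq> {s. f s \<noteq> \<zero>\<^bsub>K\<^esub>}" if "k \<in> carrier K" for f :: "'b \<Rightarrow> 'a" and k
    using that by auto
  have neg: "{s. \<ominus>\<^bsub>K\<^esub> f s \<noteq> \<zero>\<^bsub>K\<^esub>} \<subseteq> {s. f s \<noteq> \<zero>\<^bsub>K\<^esub>}" for f :: "'b \<Rightarrow> 'a"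
    by auto
  have addc: "x \<oplus>\<^bsub>free_space K S\<^esub> y \<in> carrier (free_space K S)"
    if "x \<in> carrier (free_space K S)" "y \<in> carrier (free_space K S)" for x y
    using that sub[of x y] finite_subset[OF sub[of x y]]
    by (auto simp: free_space_def) (meson K.add.m_closed rangeI subsetD)
  show ?thesis
  proof (rule moduleI)
    show "cring K" by (rule K.is_cring)
    show "abelian_group (free_space K S)"
    proof (rule abelian_groupI)
      fix x assume x: "x \<in> carrier (free_space K S)"
      show "\<exists>y\<in>carrier (free_space K S). y \<oplus>\<^bsub>free_space K S\<^esub> x = \<zero>\<^bsub>free_space K S\<^esub>"
      proof (rule bexI[of _ "\<lambda>s. \<ominus>\<^bsub>K\<^esub> x s"])
        show "(\<lambda>s. \<ominus>\<^bsub>K\<^esub> x s) \<in> carrier (free_space K S)"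
          using x neg[of x] finite_subset[OF neg[of x]] by (auto simp: free_space_def)
      qed (use x in \<open>auto simp: free_space_def K.l_neg subset_iff\<close>)
    next
      fix x y z assume "x \<in> carrier (free_space K S)" "y \<in> carrier (free_space K S)" "z \<in> carrier (free_space K S)"
      then have c: "x s \<in> carrier K" "y s \<in> carrier K" "z s \<in> carrier K" for s
        by (auto simp: free_space_def)
      show "x \<oplus>\<^bsub>free_space K S\<^esub> y \<oplus>\<^bsub>free_space K S\<^esub> z =
          x \<oplus>\<^bsub>free_space K S\<^esub> (y \<oplus>\<^bsub>free_space K S\<^esub> z)"
        using c by (simp add: free_space_def K.a_assoc)
    next
      fix x y assume "x \<in> carrier (free_space K S)" "y \<in> carrier (free_space K S)"
      then have c: "x s \<in> carrier K" "y s \<in> carrier K" for s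
        by (auto simp: free_space_def)
      show "x \<oplus>\<^bsub>free_space K S\<^esub> y = y \<oplus>\<^bsub>free_space K S\<^esub> x"
        using c by (simp add: free_space_def K.a_comm)
    next
      fix x assume "x \<in> carrier (free_space K S)"
      then have c: "x s \<in> carrier K" for s
        by (auto simp: free_space_def)
      show "\<zero>\<^bsub>free_space K S\<^esub> \<oplus>\<^bsub>free_space K S\<^esub> x = x"
        using c by (simp add: free_space_def)
    qed (use addc in \<open>auto simp: free_space_def\<close>)
  next
    fix a x assume "a \<in> carrier K" "x \<in> carrier (free_space K S)"
    then show "a \<odot>\<^bsub>free_space K S\<^esub> x \<in> carrier (free_space K S)"
      using sub2[of a x] finite_subset[OF sub2[of a x]] by (auto simp: free_space_def)
  next
    fix a b x assume ab: "a \<in> carrier K" "b \<in> carrier K" and "x \<in> carrier (free_space K S)"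
    then have c: "x s \<in> carrier K" for s
      by (auto simp: free_space_def)
    show "(a \<oplus>\<^bsub>K\<^esub> b) \<odot>\<^bsub>free_space K S\<^esub> x =
        a \<odot>\<^bsub>free_space K S\<^esub> x \<oplus>\<^bsub>free_space K S\<^esub> b \<odot>\<^bsub>free_space K S\<^esub> x"
      using ab c by (simp add: free_space_def K.l_distr)
    show "(a \<otimes>\<^bsub>K\<^esub> b) \<odot>\<^bsub>free_space K S\<^esub> x = a \<odot>\<^bsub>free_space K S\<^esub> (b \<odot>\<^bsub>free_space K S\<^esub> x)"
      using ab c by (simp add: free_space_def K.m_assoc)
  next
    fix a x y assume a: "a \<in> carrier K" and "x \<in> carrier (free_space K S)" "y \<in> carrier (free_space K S)"
    then have c: "x s \<in> carrier K" "y s \<in> carrier K" for s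
      by (auto simp: free_space_def)
    show "a \<odot>\<^bsub>free_space K S\<^esub> (x \<oplus>\<^bsub>free_space K S\<^esub> y) =
        a \<odot>\<^bsub>free_space K S\<^esub> x \<oplus>\<^bsub>free_space K S\<^esub> a \<odot>\<^bsub>free_space K S\<^esub> y"
      using a c by (simp add: free_space_def K.r_distr)
  next
    fix x assume "x \<in> carrier (free_space K S)"
    then have c: "x s \<in> carrier K" for s
      by (auto simp: free_space_def)
    show "\<one>\<^bsub>K\<^esub> \<odot>\<^bsub>free_space K S\<^esub> x = x"
      using c by (simp add: free_space_def)
  qed
qed

lemma quotient_space_module:
  assumes M: "module K F" and N: "submodule N K F"
  shows "module K (quotient_space F N)"
    and "\<And>x y. \<lbrakk>x \<in> carrier F; y \<in> carrier F\<rbrakk> \<Longrightarrow>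
      (N +>\<^bsub>F\<^esub> x) \<oplus>\<^bsub>quotient_space F N\<^esub> (N +>\<^bsub>F\<^esub> y) = N +>\<^bsub>F\<^esub> (x \<oplus>\<^bsub>F\<^esub> y)"
    and "\<And>k x. \<lbrakk>k \<in> carrier K; x \<in> carrier F\<rbrakk> \<Longrightarrow>
      k \<odot>\<^bsub>quotient_space F N\<^esub> (N +>\<^bsub>F\<^esub> x) = N +>\<^bsub>F\<^esub> (k \<odot>\<^bsub>F\<^esub> x)"
proof -
  interpret F: module K F by fact
  interpret N: submodule N K F by fact
  interpret Q: abelian_subgroup N F
    by (rule abelian_subgroupI3) (auto simp: additive_subgroup_def N.subgroup_axioms F.abelian_group_axioms)
  show add: "(N +>\<^bsub>F\<^esub> x) \<oplus>\<^bsub>quotient_space F N\<^esub> (N +>\<^bsub>F\<^esub> y) = N +>\<^bsub>F\<^esub> (x \<oplus>\<^bsub>F\<^esub> y)"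
    if "x \<in> carrier F" "y \<in> carrier F" for x y
    using that by (simp add: quotient_space_def Q.a_rcos_sum)
  show sm: "k \<odot>\<^bsub>quotient_space F N\<^esub> (N +>\<^bsub>F\<^esub> x) = N +>\<^bsub>F\<^esub> (k \<odot>\<^bsub>F\<^esub> x)"
    if k: "k \<in> carrier K" and x: "x \<in> carrier F" for k x
  proof -
    have "N +>\<^bsub>F\<^esub> (k \<odot>\<^bsub>F\<^esub> y) = N +>\<^bsub>F\<^esub> (k \<odot>\<^bsub>F\<^esub> x)" if y: "y \<in> N +>\<^bsub>F\<^esub> x" for y
    proof -
      obtain n where n: "n \<in> N" "y = n \<oplus>\<^bsub>F\<^esub> x"
        using y by (auto simp: a_r_coset_def r_coset_def)
      have nF: "n \<in> carrier F" using n(1) Q.a_subset by auto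
      have "k \<odot>\<^bsub>F\<^esub> y = k \<odot>\<^bsub>F\<^esub> n \<oplus>\<^bsub>F\<^esub> k \<odot>\<^bsub>F\<^esub> x"
        using k x nF n(2) by (simp add: F.smult_r_distr)
      moreover have "k \<odot>\<^bsub>F\<^esub> n \<in> N" using k n(1) by simp
      ultimately have "k \<odot>\<^bsub>F\<^esub> y \<in> N +>\<^bsub>F\<^esub> (k \<odot>\<^bsub>F\<^esub> x)"
        by (auto simp: a_r_coset_def r_coset_def)
      then show ?thesis
        using Q.a_repr_independence'[of "k \<odot>\<^bsub>F\<^esub> y" "k \<odot>\<^bsub>F\<^esub> x"] k x by simp
    qed
    then have "(\<Union>y\<in>N +>\<^bsub>F\<^esub> x. N +>\<^bsub>F\<^esub> (k \<odot>\<^bsub>F\<^esub> y)) = (\<Union>y\<in>N +>\<^bsub>F\<^esub> x. N +>\<^bsub>F\<^esub> (k \<odot>\<^bsub>F\<^esub> x))"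
      by (rule SUP_cong[OF refl])
    also have "\<dots> = N +>\<^bsub>F\<^esub> (k \<odot>\<^bsub>F\<^esub> x)" using Q.a_rcos_self[OF x] by auto
    finally show ?thesis unfolding quotient_space_def by simp
  qed
  have car: "\<exists>x\<in>carrier F. X = N +>\<^bsub>F\<^esub> x" if "X \<in> carrier (quotient_space F N)" for X
    using that by (auto simp: quotient_space_def A_RCOSETS_def RCOSETS_def a_r_coset_def)
  have inC: "N +>\<^bsub>F\<^esub> x \<in> carrier (quotient_space F N)" if "x \<in> carrier F" for x
    using that by (auto simp: quotient_space_def A_RCOSETS_def RCOSETS_def a_r_coset_def)
  have zero: "\<zero>\<^bsub>quotient_space F N\<^esub> = N +>\<^bsub>F\<^esub> \<zero>\<^bsub>F\<^esub>"
    using Q.a_rcos_const[of "\<zero>\<^bsub>F\<^esub>"] N.one_closed by (simp add: quotient_space_def)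
  show "module K (quotient_space F N)"
  proof (rule moduleI)
    show "cring K" by (rule F.R.is_cring)
    show "abelian_group (quotient_space F N)"
    proof (rule abelian_groupI)
      fix X assume "X \<in> carrier (quotient_space F N)"
      then obtain x where x: "x \<in> carrier F" "X = N +>\<^bsub>F\<^esub> x" using car by blast
      show "\<exists>Y\<in>carrier (quotient_space F N). Y \<oplus>\<^bsub>quotient_space F N\<^esub> X = \<zero>\<^bsub>quotient_space F N\<^esub>"
        by (rule bexI[of _ "N +>\<^bsub>F\<^esub> (\<ominus>\<^bsub>F\<^esub> x)"]) (use x in \<open>auto simp: add zero F.l_neg inC\<close>)
    qed (auto dest!: car simp: add zero inC F.a_assoc F.a_comm F.a_lcomm)
  qed (auto dest!: car simp: add sm inC F.smult_l_distr F.smult_r_distr F.smult_assoc1)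
qed

lemma tensor_relations_sub:
  assumes "field K" "module K A" "module K B"
  shows "tensor_relations K A B \<subseteq> carrier (free_space K (carrier A \<times> carrier B))"
proof -
  interpret K: field K by fact
  interpret A: module K A by fact
  interpret B: module K B by fact
  interpret F: module K "free_space K (carrier A \<times> carrier B)" by (rule free_space_module) fact
  have g: "free_gen K (a, b) \<in> carrier (free_space K (carrier A \<times> carrier B))"
    if "a \<in> carrier A" "b \<in> carrier B" for a b
    using that by (auto simp: free_gen_def free_space_def)
  show ?thesis
    unfolding tensor_relations_def Let_def by (auto intro!: F.minus_closed F.a_closed g)
qed

lemma tensor_null_submodule:
  assumes "field K" "module K A" "module K B"
  shows "submodule (tensor_null K A B) K (free_space K (carrier A \<times> carrier B))"
proof -
  interpret F: module K "free_space K (carrier A \<times> carrier B)" by (rule free_space_module) fact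
  let ?F = "free_space K (carrier A \<times> carrier B)"
  have c: "submodule (carrier ?F) K ?F" by (rule F.carrier_is_submodule)
  show ?thesis
  proof (rule F.submoduleI)
    show "tensor_null K A B \<subseteq> carrier ?F"
      unfolding tensor_null_def using c tensor_relations_sub[OF assms] by blast
    show "\<zero>\<^bsub>?F\<^esub> \<in> tensor_null K A B"
      unfolding tensor_null_def by (auto dest!: submodule.axioms(1) subgroup.one_closed)
  qed (auto simp: tensor_null_def F.submoduleE)
qed

lemma tensor_module:
  assumes "field K" "module K A" "module K B"
  shows "module K (tensor K A B)"
  unfolding tensor_def
  by (intro quotient_space_module free_space_module tensor_null_submodule assms)

lemma pure_tensor_bilinear:
  assumes KAB: "field K" "module K A" "module K B"
  shows "bilinear_map K A B (tensor K A B) (pure_tensor K A B)"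
proof -
  interpret K: field K by fact
  interpret A: module K A by fact
  interpret B: module K B by fact
  let ?F = "free_space K (carrier A \<times> carrier B)"
  let ?N = "tensor_null K A B"
  interpret F: module K ?F by (rule free_space_module) fact
  interpret N: submodule ?N K ?F by (rule tensor_null_submodule) fact+
  interpret Q: abelian_subgroup ?N ?F
    by (rule abelian_subgroupI3) (auto simp: additive_subgroup_def N.subgroup_axioms F.abelian_group_axioms)
  have g: "free_gen K (a, b) \<in> carrier ?F" if "a \<in> carrier A" "b \<in> carrier B" for a b
    using that by (auto simp: free_gen_def free_space_def)
  note q = quotient_space_module[OF free_space_module[OF KAB(1)] tensor_null_submodule[OF KAB]]
  have eq: "?N +>\<^bsub>?F\<^esub> x = ?N +>\<^bsub>?F\<^esub> y"
    if "x \<ominus>\<^bsub>?F\<^esub> y \<in> tensor_relations K A B" "x \<in> carrier ?F" "y \<in> carrier ?F" for x y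
  proof -
    have n: "x \<ominus>\<^bsub>?F\<^esub> y \<in> ?N" using that(1) by (auto simp: tensor_null_def)
    have "x = (x \<ominus>\<^bsub>?F\<^esub> y) \<oplus>\<^bsub>?F\<^esub> y" using that(2,3) by (simp add: F.minus_eq F.a_assoc F.l_neg)
    then have "x \<in> ?N +>\<^bsub>?F\<^esub> y" using n by (auto simp: a_r_coset_def r_coset_def)
    then show ?thesis using Q.a_repr_independence' that(3) by metis
  qed
  have c: "pure_tensor K A B a b \<in> carrier (tensor K A B)"
    if "a \<in> carrier A" "b \<in> carrier B" for a b
    using g[OF that] by (auto simp: tensor_def quotient_space_def pure_tensor_def
      A_RCOSETS_def RCOSETS_def a_r_coset_def)
  have rel: "free_gen K (a \<oplus>\<^bsub>A\<^esub> a', b) \<ominus>\<^bsub>?F\<^esub> (free_gen K (a, b) \<oplus>\<^bsub>?F\<^esub> free_gen K (a', b)) \<in> tensor_relations K A B"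
    if "a \<in> carrier A" "a' \<in> carrier A" "b \<in> carrier B" for a a' b
    using that unfolding tensor_relations_def Let_def by blast
  have rel2: "free_gen K (a, b \<oplus>\<^bsub>B\<^esub> b') \<ominus>\<^bsub>?F\<^esub> (free_gen K (a, b) \<oplus>\<^bsub>?F\<^esub> free_gen K (a, b')) \<in> tensor_relations K A B"
    if "a \<in> carrier A" "b \<in> carrier B" "b' \<in> carrier B" for a b b'
    using that unfolding tensor_relations_def Let_def by blast
  have rel3: "free_gen K (k \<odot>\<^bsub>A\<^esub> a, b) \<ominus>\<^bsub>?F\<^esub> k \<odot>\<^bsub>?F\<^esub> free_gen K (a, b) \<in> tensor_relations K A B"
    if "k \<in> carrier K" "a \<in> carrier A" "b \<in> carrier B" for k a b
    using that unfolding tensor_relations_def Let_def by blast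
  have rel4: "free_gen K (a, k \<odot>\<^bsub>B\<^esub> b) \<ominus>\<^bsub>?F\<^esub> k \<odot>\<^bsub>?F\<^esub> free_gen K (a, b) \<in> tensor_relations K A B"
    if "k \<in> carrier K" "a \<in> carrier A" "b \<in> carrier B" for k a b
    using that unfolding tensor_relations_def Let_def by blast
  have "pure_tensor K A B (a \<oplus>\<^bsub>A\<^esub> a') b =
      pure_tensor K A B a b \<oplus>\<^bsub>tensor K A B\<^esub> pure_tensor K A B a' b"
    if "a \<in> carrier A" "a' \<in> carrier A" "b \<in> carrier B" for a a' b
    using eq[OF rel[OF that]] q(2)[folded tensor_def] that by (simp add: pure_tensor_def g)
  moreover have "pure_tensor K A B a (b \<oplus>\<^bsub>B\<^esub> b') =
      pure_tensor K A B a b \<oplus>\<^bsub>tensor K A B\<^esub> pure_tensor K A B a b'"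
    if "a \<in> carrier A" "b \<in> carrier B" "b' \<in> carrier B" for a b b'
    using eq[OF rel2[OF that]] q(2)[folded tensor_def] that by (simp add: pure_tensor_def g)
  moreover have "pure_tensor K A B (k \<odot>\<^bsub>A\<^esub> a) b = k \<odot>\<^bsub>tensor K A B\<^esub> pure_tensor K A B a b"
    if "k \<in> carrier K" "a \<in> carrier A" "b \<in> carrier B" for k a b
    using eq[OF rel3[OF that]] q(3)[folded tensor_def] that by (simp add: pure_tensor_def g)
  moreover have "pure_tensor K A B a (k \<odot>\<^bsub>B\<^esub> b) = k \<odot>\<^bsub>tensor K A B\<^esub> pure_tensor K A B a b"
    if "k \<in> carrier K" "a \<in> carrier A" "b \<in> carrier B" for k a b
    using eq[OF rel4[OF that]] q(3)[folded tensor_def] that by (simp add: pure_tensor_def g)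
  ultimately show ?thesis
    unfolding bilinear_map_def linear_maps_def by (simp add: c Pi_iff)
qed

lemma free_space_ext:
  assumes K: "field K" and P: "module K P" and f: "f \<in> S \<rightarrow> carrier P"
  shows "\<exists>h\<in>linear_maps K (free_space K S) P. \<forall>s\<in>S. h (free_gen K s) = f s"
proof -
  interpret K: field K by fact
  interpret P: module K P by fact
  let ?F = "free_space K S"
  define h where "h = (\<lambda>\<phi>. \<Oplus>\<^bsub>P\<^esub>s\<in>{s. \<phi> s \<noteq> \<zero>\<^bsub>K\<^esub>}. \<phi> s \<odot>\<^bsub>P\<^esub> f s)"
  have F: "\<phi> s \<in> carrier K" "finite {s. \<phi> s \<noteq> \<zero>\<^bsub>K\<^esub>}" "\<phi> s \<noteq> \<zero>\<^bsub>K\<^esub> \<Longrightarrow> s \<in> S"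
    if "\<phi> \<in> carrier ?F" for \<phi> s
    using that by (auto simp: free_space_def)
  have fs: "f s \<in> carrier P" if "s \<in> S" for s using f that by auto
  have h_eq: "h \<phi> = (\<Oplus>\<^bsub>P\<^esub>s\<in>T. \<phi> s \<odot>\<^bsub>P\<^esub> f s)"
    if "\<phi> \<in> carrier ?F" "finite T" "{s. \<phi> s \<noteq> \<zero>\<^bsub>K\<^esub>} \<subseteq> T" "T \<subseteq> S" for \<phi> T
    unfolding h_def
    by (rule P.add.finprod_mono_neutral_cong_left) (use that fs F[OF that(1)] in \<open>auto simp: Pi_iff\<close>)
  have "h \<in> linear_maps K ?F P"
    unfolding linear_maps_def
  proof (intro CollectI conjI ballI Pi_I)
    fix \<phi> assume a: "\<phi> \<in> carrier ?F"
    show "h \<phi> \<in> carrier P"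
      unfolding h_def by (rule P.finsum_closed) (use F[OF a] fs in auto)
  next
    fix \<phi> \<psi> assume a: "\<phi> \<in> carrier ?F" and b: "\<psi> \<in> carrier ?F"
    let ?T = "{s. \<phi> s \<noteq> \<zero>\<^bsub>K\<^esub>} \<union> {s. \<psi> s \<noteq> \<zero>\<^bsub>K\<^esub>}"
    have T: "finite ?T" "?T \<subseteq> S" using F[OF a] F[OF b] by auto
    have ab: "\<phi> \<oplus>\<^bsub>?F\<^esub> \<psi> \<in> carrier ?F"
      using abelian_monoid.a_closed[of ?F] free_space_module[OF K, of S] a b
      by (simp add: module_def abelian_group_def)
    have "h (\<phi> \<oplus>\<^bsub>?F\<^esub> \<psi>) = (\<Oplus>\<^bsub>P\<^esub>s\<in>?T. (\<phi> \<oplus>\<^bsub>?F\<^esub> \<psi>) s \<odot>\<^bsub>P\<^esub> f s)"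
      by (rule h_eq[OF ab T(1) _ T(2)]) (auto simp: free_space_def)
    also have "\<dots> = (\<Oplus>\<^bsub>P\<^esub>s\<in>?T. \<phi> s \<odot>\<^bsub>P\<^esub> f s \<oplus>\<^bsub>P\<^esub> \<psi> s \<odot>\<^bsub>P\<^esub> f s)"
      by (rule P.finsum_cong')
        (use T F[OF a] F[OF b] fs in \<open>auto simp: free_space_def P.smult_l_distr\<close>)
    also have "\<dots> = (\<Oplus>\<^bsub>P\<^esub>s\<in>?T. \<phi> s \<odot>\<^bsub>P\<^esub> f s) \<oplus>\<^bsub>P\<^esub> (\<Oplus>\<^bsub>P\<^esub>s\<in>?T. \<psi> s \<odot>\<^bsub>P\<^esub> f s)"
      by (rule P.finsum_addf) (use T F[OF a] F[OF b] fs in auto)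
    also have "(\<Oplus>\<^bsub>P\<^esub>s\<in>?T. \<phi> s \<odot>\<^bsub>P\<^esub> f s) = h \<phi>"
      by (rule h_eq[OF a T(1) _ T(2), symmetric]) auto
    also have "(\<Oplus>\<^bsub>P\<^esub>s\<in>?T. \<psi> s \<odot>\<^bsub>P\<^esub> f s) = h \<psi>"
      by (rule h_eq[OF b T(1) _ T(2), symmetric]) auto
    finally show "h (\<phi> \<oplus>\<^bsub>?F\<^esub> \<psi>) = h \<phi> \<oplus>\<^bsub>P\<^esub> h \<psi>" .
  next
    fix k \<phi> assume k: "k \<in> carrier K" and a: "\<phi> \<in> carrier ?F"
    let ?T = "{s. \<phi> s \<noteq> \<zero>\<^bsub>K\<^esub>}"
    have T: "finite ?T" "?T \<subseteq> S" using F[OF a] by auto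
    have ka: "k \<odot>\<^bsub>?F\<^esub> \<phi> \<in> carrier ?F"
      using module.smult_closed[OF free_space_module[OF K]] k a by blast
    have "h (k \<odot>\<^bsub>?F\<^esub> \<phi>) = (\<Oplus>\<^bsub>P\<^esub>s\<in>?T. (k \<odot>\<^bsub>?F\<^esub> \<phi>) s \<odot>\<^bsub>P\<^esub> f s)"
      by (rule h_eq[OF ka T(1) _ T(2)]) (use k in \<open>auto simp: free_space_def\<close>)
    also have "\<dots> = (\<Oplus>\<^bsub>P\<^esub>s\<in>?T. k \<odot>\<^bsub>P\<^esub> (\<phi> s \<odot>\<^bsub>P\<^esub> f s))"
      by (rule P.finsum_cong')
        (use k T F[OF a] fs in \<open>auto simp: free_space_def P.smult_assoc1\<close>)
    also have "\<dots> = k \<odot>\<^bsub>P\<^esub> h \<phi>"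
      unfolding h_def by (rule P.finsum_smult_ldistr[symmetric]) (use k T F[OF a] fs in auto)
    finally show "h (k \<odot>\<^bsub>?F\<^esub> \<phi>) = k \<odot>\<^bsub>P\<^esub> h \<phi>" .
  qed
  moreover have "h (free_gen K s) = f s" if s: "s \<in> S" for s
  proof -
    have "free_gen K s \<in> carrier ?F" using s by (auto simp: free_gen_def free_space_def)
    then have "h (free_gen K s) = (\<Oplus>\<^bsub>P\<^esub>t\<in>{s}. free_gen K s t \<odot>\<^bsub>P\<^esub> f t)"
      by (rule h_eq) (use s in \<open>auto simp: free_gen_def\<close>)
    also have "\<dots> = f s" using fs[OF s] by (simp add: free_gen_def)
    finally show ?thesis .
  qed
  ultimately show ?thesis by blast
qed

lemma free_space_induct:
  assumes K: "field K" and N: "submodule N K (free_space K S)"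
    and gen: "\<And>s. s \<in> S \<Longrightarrow> free_gen K s \<in> N"
  shows "carrier (free_space K S) \<subseteq> N"
proof
  interpret K: field K by fact
  let ?F = "free_space K S"
  interpret F: module K ?F by (rule free_space_module) fact
  interpret N: submodule N K ?F by fact
  have "\<forall>\<phi>\<in>carrier ?F. {s. \<phi> s \<noteq> \<zero>\<^bsub>K\<^esub>} \<subseteq> T \<longrightarrow> \<phi> \<in> N" if "finite T" for T
    using that
  proof (induction T)
    case empty
    have "\<phi> = \<zero>\<^bsub>?F\<^esub>" if "{s. \<phi> s \<noteq> \<zero>\<^bsub>K\<^esub>} \<subseteq> {}" for \<phi>
      using that by (auto simp: free_space_def)
    then show ?case using N.one_closed by auto
  next
    case (insert t T)
    show ?case
    proof (intro ballI impI)
      fix \<phi> assume \<phi>: "\<phi> \<in> carrier ?F" and sub: "{s. \<phi> s \<noteq> \<zero>\<^bsub>K\<^esub>} \<subseteq> insert t T"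
      show "\<phi> \<in> N"
      proof (cases "\<phi> t = \<zero>\<^bsub>K\<^esub>")
        case True
        then have "{s. \<phi> s \<noteq> \<zero>\<^bsub>K\<^esub>} \<subseteq> T" using sub by auto
        then show ?thesis using insert.IH \<phi> by auto
      next
        case False
        have t: "t \<in> S" using False \<phi> by (auto simp: free_space_def)
        have c: "\<phi> s \<in> carrier K" for s using \<phi> by (auto simp: free_space_def)
        define \<psi> where "\<psi> = \<phi>(t := \<zero>\<^bsub>K\<^esub>)"
        have fin: "finite {s. \<psi> s \<noteq> \<zero>\<^bsub>K\<^esub>}"
          by (rule finite_subset[of _ "{s. \<phi> s \<noteq> \<zero>\<^bsub>K\<^esub>}"])
            (use \<phi> in \<open>auto simp: \<psi>_def free_space_def\<close>)
        have "\<psi> \<in> carrier ?F" using \<phi> fin by (auto simp: \<psi>_def free_space_def)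
        moreover have "{s. \<psi> s \<noteq> \<zero>\<^bsub>K\<^esub>} \<subseteq> T" using sub by (auto simp: \<psi>_def)
        ultimately have "\<psi> \<in> N" using insert.IH by auto
        moreover have "\<phi> t \<odot>\<^bsub>?F\<^esub> free_gen K t \<in> N" using gen[OF t] c by (rule N.smult_closed[rotated])
        ultimately have "\<psi> \<oplus>\<^bsub>?F\<^esub> \<phi> t \<odot>\<^bsub>?F\<^esub> free_gen K t \<in> N" using N.m_closed by simp
        moreover have "\<phi> = \<psi> \<oplus>\<^bsub>?F\<^esub> \<phi> t \<odot>\<^bsub>?F\<^esub> free_gen K t"
          using c by (auto simp: fun_eq_iff \<psi>_def free_space_def free_gen_def)
        ultimately show ?thesis by simp
      qed
    qed
  qed
  then show "\<phi> \<in> N" if "\<phi> \<in> carrier ?F" for \<phi> using that by (auto simp: free_space_def)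
qed

lemma linear_zero:
  assumes "module K M" "module K P" "h \<in> linear_maps K M P"
  shows "h \<zero>\<^bsub>M\<^esub> = \<zero>\<^bsub>P\<^esub>"
proof -
  interpret M: module K M by fact
  interpret P: module K P by fact
  have "h (\<zero>\<^bsub>K\<^esub> \<odot>\<^bsub>M\<^esub> \<zero>\<^bsub>M\<^esub>) = \<zero>\<^bsub>K\<^esub> \<odot>\<^bsub>P\<^esub> h \<zero>\<^bsub>M\<^esub>" "h \<zero>\<^bsub>M\<^esub> \<in> carrier P"
    using assms(3) M.zero_closed M.R.zero_closed unfolding linear_maps_def by blast+
  then show ?thesis by simp
qed

lemma linear_neg:
  assumes "module K M" "module K P" "h \<in> linear_maps K M P" "x \<in> carrier M"
  shows "h (\<ominus>\<^bsub>M\<^esub> x) = \<ominus>\<^bsub>P\<^esub> h x"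
proof -
  interpret M: module K M by fact
  interpret P: module K P by fact
  have c: "h x \<in> carrier P" "h (\<ominus>\<^bsub>M\<^esub> x) \<in> carrier P" using assms(3,4) by (auto simp: linear_maps_def)
  have "h (\<ominus>\<^bsub>M\<^esub> x \<oplus>\<^bsub>M\<^esub> x) = h (\<ominus>\<^bsub>M\<^esub> x) \<oplus>\<^bsub>P\<^esub> h x"
    using assms(3,4) by (simp add: linear_maps_def)
  then have "h (\<ominus>\<^bsub>M\<^esub> x) \<oplus>\<^bsub>P\<^esub> h x = \<zero>\<^bsub>P\<^esub>"
    using assms(4) linear_zero[OF assms(1-3)] by (simp add: M.l_neg)
  then show ?thesis using c by (simp add: P.minus_equality)
qed

lemma linear_equalizer_submodule:
  assumes "module K M" "module K P" "h \<in> linear_maps K M P" "h' \<in> linear_maps K M P"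
  shows "submodule {x \<in> carrier M. h x = h' x} K M"
proof -
  interpret M: module K M by fact
  show ?thesis
    by (rule M.submoduleI)
      (use assms(3,4) linear_zero[OF assms(1-3)] linear_zero[OF assms(1,2,4)]
        linear_neg[OF assms(1-3)] linear_neg[OF assms(1,2,4)] in \<open>auto simp: linear_maps_def\<close>)
qed

lemma tensor_universal:
  assumes KAB: "field K" "module K A" "module K B" and P: "module K P"
    and f: "bilinear_map K A B P f"
  shows "\<exists>!h. h \<in> carrier (Hom_space K (tensor K A B) P) \<and>
    (\<forall>a\<in>carrier A. \<forall>b\<in>carrier B. h (pure_tensor K A B a b) = f a b)"
proof -
  interpret K: field K by fact
  interpret A: module K A by fact
  interpret B: module K B by fact
  interpret P: module K P by fact
  let ?S = "carrier A \<times> carrier B"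
  let ?F = "free_space K ?S"
  let ?N = "tensor_null K A B"
  let ?T = "tensor K A B"
  interpret F: module K ?F by (rule free_space_module) fact
  interpret N: submodule ?N K ?F by (rule tensor_null_submodule) fact+
  interpret Q: abelian_subgroup ?N ?F
    by (rule abelian_subgroupI3) (auto simp: additive_subgroup_def N.subgroup_axioms F.abelian_group_axioms)
  interpret T: module K ?T by (rule tensor_module) fact+
  note q = quotient_space_module(2,3)[OF free_space_module[OF KAB(1)] tensor_null_submodule[OF KAB], folded tensor_def]
  have g: "free_gen K (a, b) \<in> carrier ?F" if "a \<in> carrier A" "b \<in> carrier B" for a b
    using that by (auto simp: free_gen_def free_space_def)
  have car: "\<exists>x\<in>carrier ?F. X = ?N +>\<^bsub>?F\<^esub> x" if "X \<in> carrier ?T" for X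
    using that by (auto simp: tensor_def quotient_space_def A_RCOSETS_def RCOSETS_def a_r_coset_def)
  have inC: "?N +>\<^bsub>?F\<^esub> x \<in> carrier ?T" if "x \<in> carrier ?F" for x
    using that by (auto simp: tensor_def quotient_space_def A_RCOSETS_def RCOSETS_def a_r_coset_def)
  have fc: "f a b \<in> carrier P" if "a \<in> carrier A" "b \<in> carrier B" for a b
    using f that by (auto simp: bilinear_map_def linear_maps_def)
  obtain h where h: "h \<in> linear_maps K ?F P"
    and hg: "\<And>a b. \<lbrakk>a \<in> carrier A; b \<in> carrier B\<rbrakk> \<Longrightarrow> h (free_gen K (a, b)) = f a b"
    using free_space_ext[OF KAB(1) P, of "\<lambda>(a, b). f a b" ?S] fc by (auto simp: Pi_iff)
  have hadd: "h (x \<oplus>\<^bsub>?F\<^esub> y) = h x \<oplus>\<^bsub>P\<^esub> h y" if "x \<in> carrier ?F" "y \<in> carrier ?F" for x y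
    using h that by (auto simp: linear_maps_def)
  have hsm: "h (k \<odot>\<^bsub>?F\<^esub> x) = k \<odot>\<^bsub>P\<^esub> h x" if "k \<in> carrier K" "x \<in> carrier ?F" for x k
    using h that by (auto simp: linear_maps_def)
  have hc: "h x \<in> carrier P" if "x \<in> carrier ?F" for x
    using h that by (auto simp: linear_maps_def)
  have hminus: "h (x \<ominus>\<^bsub>?F\<^esub> y) = \<zero>\<^bsub>P\<^esub>" if "x \<in> carrier ?F" "y \<in> carrier ?F" "h x = h y" for x y
    using that linear_neg[OF F.module_axioms P h that(2)] hadd[of x "\<ominus>\<^bsub>?F\<^esub> y"] hc
    by (simp add: a_minus_def P.r_neg)
  have z: "(\<lambda>_. \<zero>\<^bsub>P\<^esub>) \<in> linear_maps K ?F P" by (auto simp: linear_maps_def)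
  have fbil: "f (a \<oplus>\<^bsub>A\<^esub> a') b = f a b \<oplus>\<^bsub>P\<^esub> f a' b" "f a (b \<oplus>\<^bsub>B\<^esub> b') = f a b \<oplus>\<^bsub>P\<^esub> f a b'"
    if "a \<in> carrier A" "a' \<in> carrier A" "b \<in> carrier B" "b' \<in> carrier B" for a a' b b'
    using f that by (auto simp: bilinear_map_def linear_maps_def)
  have fsm: "f (k \<odot>\<^bsub>A\<^esub> a) b = k \<odot>\<^bsub>P\<^esub> f a b" "f a (k \<odot>\<^bsub>B\<^esub> b) = k \<odot>\<^bsub>P\<^esub> f a b"
    if "k \<in> carrier K" "a \<in> carrier A" "b \<in> carrier B" for a b k
    using f that by (auto simp: bilinear_map_def linear_maps_def)
  have "h x = \<zero>\<^bsub>P\<^esub>" if "x \<in> tensor_relations K A B" for x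
    using that fbil(1)[OF _ _ _ B.zero_closed] fbil(2)[OF _ A.zero_closed]
    unfolding tensor_relations_def Let_def
    by (auto intro!: hminus g F.a_closed F.smult_closed simp: hadd hsm hg fsm g)
  then have "tensor_relations K A B \<subseteq> {x \<in> carrier ?F. h x = \<zero>\<^bsub>P\<^esub>}"
    using tensor_relations_sub[OF KAB] by blast
  then have null: "h x = \<zero>\<^bsub>P\<^esub>" if "x \<in> ?N" for x
    using that linear_equalizer_submodule[OF F.module_axioms P h z]
    unfolding tensor_null_def by auto
  have const: "h y = h x" if "y \<in> ?N +>\<^bsub>?F\<^esub> x" "x \<in> carrier ?F" for x y
  proof -
    have "\<exists>n\<in>?N. y = n \<oplus>\<^bsub>?F\<^esub> x" using that(1) unfolding a_r_coset_def r_coset_def by simp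
    then obtain n where n: "n \<in> ?N" "y = n \<oplus>\<^bsub>?F\<^esub> x" by (rule bexE)
    have "n \<in> carrier ?F" using n(1) N.subset by auto
    then show ?thesis using n null that hadd[of n x] hc by simp
  qed
  define h' where "h' = (\<lambda>X\<in>carrier ?T. h (SOME x. x \<in> X))"
  have h'_eq: "h' (?N +>\<^bsub>?F\<^esub> x) = h x" if "x \<in> carrier ?F" for x
  proof -
    have "(SOME y. y \<in> ?N +>\<^bsub>?F\<^esub> x) \<in> ?N +>\<^bsub>?F\<^esub> x"
      by (rule someI[of "\<lambda>y. y \<in> ?N +>\<^bsub>?F\<^esub> x" x, OF Q.a_rcos_self[OF that]])
    then show ?thesis using const that inC by (simp add: h'_def)
  qed
  have h'_lin: "h' \<in> linear_maps K ?T P"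
    unfolding linear_maps_def
  proof (intro CollectI conjI ballI Pi_I)
    fix X assume "X \<in> carrier ?T"
    then obtain x where x: "x \<in> carrier ?F" "X = ?N +>\<^bsub>?F\<^esub> x" using car by blast
    then show "h' X \<in> carrier P" using h'_eq hc by simp
    fix Y assume "Y \<in> carrier ?T"
    then obtain y where y: "y \<in> carrier ?F" "Y = ?N +>\<^bsub>?F\<^esub> y" using car by blast
    show "h' (X \<oplus>\<^bsub>?T\<^esub> Y) = h' X \<oplus>\<^bsub>P\<^esub> h' Y"
      using x y by (simp add: q h'_eq hadd)
  next
    fix k X assume k: "k \<in> carrier K" and "X \<in> carrier ?T"
    then obtain x where x: "x \<in> carrier ?F" "X = ?N +>\<^bsub>?F\<^esub> x" using car by blast
    show "h' (k \<odot>\<^bsub>?T\<^esub> X) = k \<odot>\<^bsub>P\<^esub> h' X"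
      using x k by (simp add: q h'_eq hsm)
  qed
  show ?thesis
  proof (rule ex1I[of _ h'], intro conjI ballI)
    show "h' \<in> carrier (Hom_space K ?T P)"
      using h'_lin by (simp add: Hom_space_def h'_def)
    show "h' (pure_tensor K A B a b) = f a b" if "a \<in> carrier A" "b \<in> carrier B" for a b
      using that by (simp add: pure_tensor_def h'_eq g hg)
  next
    fix u assume u: "u \<in> carrier (Hom_space K ?T P) \<and>
      (\<forall>a\<in>carrier A. \<forall>b\<in>carrier B. u (pure_tensor K A B a b) = f a b)"
    have up: "u (?N +>\<^bsub>?F\<^esub> free_gen K (a, b)) = f a b" if "a \<in> carrier A" "b \<in> carrier B" for a b
      using u that by (auto simp: pure_tensor_def)
    have ul: "u \<in> linear_maps K ?T P" and ue: "u \<in> extensional (carrier ?T)"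
      using u by (auto simp: Hom_space_def)
    have "(\<lambda>x. u (?N +>\<^bsub>?F\<^esub> x)) \<in> linear_maps K ?F P"
      using ul inC by (auto simp: linear_maps_def q[symmetric])
    then have "submodule {x \<in> carrier ?F. u (?N +>\<^bsub>?F\<^esub> x) = h x} K ?F"
      by (intro linear_equalizer_submodule[OF F.module_axioms P] h)
    from free_space_induct[OF KAB(1) this]
    have "u (?N +>\<^bsub>?F\<^esub> x) = h x" if "x \<in> carrier ?F" for x
      using that up hg g by auto
    then have "u X = h' X" if "X \<in> carrier ?T" for X
      using car[OF that] h'_eq by auto
    then show "u = h'"
      by (intro extensionalityI[OF ue, of h']) (auto simp: h'_def)
  qed
qed

lemma tensor_lift:
  assumes "field K" "module K A" "module K B" "module K P" "bilinear_map K A B P f"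
  shows "tensor_lift K A B P f \<in> carrier (Hom_space K (tensor K A B) P)"
    and "\<And>a b. \<lbrakk>a \<in> carrier A; b \<in> carrier B\<rbrakk> \<Longrightarrow>
      tensor_lift K A B P f (pure_tensor K A B a b) = f a b"
  using theI'[OF tensor_universal[OF assms]] unfolding tensor_lift_def by auto

end

(* For a functional phi on H_beta let S_phi F = (I (x) phi) Delta_{alpha,beta} F. Coassociativity of H shows
   that S_phi maps W_{alpha beta} to W_alpha and that S_phi S_psi = S_chi with
   chi = (phi (x) psi) Delta_{beta,gamma}; the counit axiom is S_epsilon = I. The coaction Omega is
   characterised by (I (x) phi) Omega(F) = S_phi F for all phi. Since elements of A (x) H_beta are separated
   by the maps I (x) g_i, the comodule axioms for Omega follow from these identities. *)
theory Submission
  imports Defs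
begin

section \<open>Linear maps and finite sums\<close>

text \<open>The obstacle is that \<open>W alpha (x) H beta\<close> is a quotient of its own free
  space, built from \<open>W alpha\<close> alone, so tensors over \<open>W\<close> cannot be read as
  tensors over \<open>Hom(V_1, H_alpha)\<close> without an injectivity argument. Slices get round
  this: they land in \<open>W alpha\<close>, whose elements are functions, and there equality is
  tested at each \<open>v\<close> in \<open>V_1\<close>. Evaluation at \<open>v\<close> turns every
  claim about \<open>S_phi\<close> into one about the comultiplication of \<open>H\<close>.
  Stability of \<open>W\<close> under slicing is a matter of different tensor legs:
  \<open>L_{1,alpha}\<close> applies \<open>sigma_1\<close> to the first leg while
  \<open>phi\<close> contracts the last, and coassociativity lets the two commute. In the threefold
  tensor product, \<open>H_gamma\<close> is contracted first and \<open>H_beta\<close> second. This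
  uses the given dual bases one at a time and requires no dual basis of
  \<open>H_beta (x) H_gamma\<close>.\<close>

lemma linear_mapsI:
  assumes "\<And>x. x \<in> carrier M \<Longrightarrow> f x \<in> carrier N"
    and "\<And>x y. \<lbrakk>x \<in> carrier M; y \<in> carrier M\<rbrakk> \<Longrightarrow> f (x \<oplus>\<^bsub>M\<^esub> y) = f x \<oplus>\<^bsub>N\<^esub> f y"
    and "\<And>k x. \<lbrakk>k \<in> carrier K; x \<in> carrier M\<rbrakk> \<Longrightarrow> f (k \<odot>\<^bsub>M\<^esub> x) = k \<odot>\<^bsub>N\<^esub> f x"
  shows "f \<in> linear_maps K M N"
  using assms by (auto simp: linear_maps_def)

lemma linear_mapsD:
  assumes "f \<in> linear_maps K M N"
  shows "x \<in> carrier M \<Longrightarrow> f x \<in> carrier N"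
    and "\<lbrakk>x \<in> carrier M; y \<in> carrier M\<rbrakk> \<Longrightarrow> f (x \<oplus>\<^bsub>M\<^esub> y) = f x \<oplus>\<^bsub>N\<^esub> f y"
    and "\<lbrakk>k \<in> carrier K; x \<in> carrier M\<rbrakk> \<Longrightarrow> f (k \<odot>\<^bsub>M\<^esub> x) = k \<odot>\<^bsub>N\<^esub> f x"
  using assms by (auto simp: linear_maps_def)

lemma linear_id: "(\<lambda>x. x) \<in> linear_maps K M M"
  by (simp add: linear_maps_def)

lemma linear_comp:
  assumes "f \<in> linear_maps K M N" "h \<in> linear_maps K N P"
  shows "(\<lambda>x. h (f x)) \<in> linear_maps K M P"
  by (rule linear_mapsI) (simp_all add: linear_mapsD[OF assms(1)] linear_mapsD[OF assms(2)])

lemma linear_finsum: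
  assumes "module K M" "module K P" and h: "h \<in> linear_maps K M P"
    and "finite I" "x \<in> I \<rightarrow> carrier M"
  shows "h (\<Oplus>\<^bsub>M\<^esub>i\<in>I. x i) = (\<Oplus>\<^bsub>P\<^esub>i\<in>I. h (x i))"
proof -
  interpret M: module K M by fact
  interpret P: module K P by fact
  show ?thesis
    using assms(4,5)
  proof (induction I)
    case empty
    then show ?case using linear_zero[OF assms(1-3)] by simp
  next
    case (insert i I)
    have "x i \<in> carrier M" "x \<in> I \<rightarrow> carrier M" using insert.prems by auto
    moreover from this have "(\<lambda>i. h (x i)) \<in> I \<rightarrow> carrier P" "h (x i) \<in> carrier P"
      using linear_mapsD(1)[OF h] by auto
    ultimately show ?case
      using insert by (simp add: linear_mapsD(2)[OF h])
  qed
qed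

text \<open>Needed because both the coaction and the expansion of a tensor along a dual basis are
  finite sums whose dependence on the argument must be linear.\<close>

lemma linear_sum_maps:
  assumes "module K M" "module K P" "finite I"
    and f: "\<And>i. i \<in> I \<Longrightarrow> f i \<in> linear_maps K M P"
  shows "(\<lambda>x. \<Oplus>\<^bsub>P\<^esub>i\<in>I. f i x) \<in> linear_maps K M P"
proof -
  interpret M: module K M by fact
  interpret P: module K P by fact
  have c: "(\<lambda>i. f i x) \<in> I \<rightarrow> carrier P" if "x \<in> carrier M" for x
    using f that by (auto dest: linear_mapsD)
  show ?thesis
  proof (rule linear_mapsI)
    show "(\<Oplus>\<^bsub>P\<^esub>i\<in>I. f i x) \<in> carrier P" if "x \<in> carrier M" for x
      by (rule P.finsum_closed[OF c[OF that]])
  next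
    fix x y assume xy: "x \<in> carrier M" "y \<in> carrier M"
    have "(\<Oplus>\<^bsub>P\<^esub>i\<in>I. f i (x \<oplus>\<^bsub>M\<^esub> y)) = (\<Oplus>\<^bsub>P\<^esub>i\<in>I. f i x \<oplus>\<^bsub>P\<^esub> f i y)"
      by (rule P.finsum_cong') (use f xy c in \<open>auto dest: linear_mapsD\<close>)
    then show "(\<Oplus>\<^bsub>P\<^esub>i\<in>I. f i (x \<oplus>\<^bsub>M\<^esub> y)) = (\<Oplus>\<^bsub>P\<^esub>i\<in>I. f i x) \<oplus>\<^bsub>P\<^esub> (\<Oplus>\<^bsub>P\<^esub>i\<in>I. f i y)"
      using P.finsum_addf[OF c[OF xy(1)] c[OF xy(2)]] by simp
  next
    fix k x assume k: "k \<in> carrier K" and x: "x \<in> carrier M"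
    have "(\<Oplus>\<^bsub>P\<^esub>i\<in>I. f i (k \<odot>\<^bsub>M\<^esub> x)) = (\<Oplus>\<^bsub>P\<^esub>i\<in>I. k \<odot>\<^bsub>P\<^esub> f i x)"
      by (rule P.finsum_cong') (use f k x c in \<open>auto dest: linear_mapsD\<close>)
    then show "(\<Oplus>\<^bsub>P\<^esub>i\<in>I. f i (k \<odot>\<^bsub>M\<^esub> x)) = k \<odot>\<^bsub>P\<^esub> (\<Oplus>\<^bsub>P\<^esub>i\<in>I. f i x)"
      using P.finsum_smult_ldistr[OF assms(3) k c[OF x]] by simp
  qed
qed

lemma base_space_module:
  assumes "field K"
  shows "module K (base_space K)"
proof -
  interpret K: field K by fact
  show ?thesis
    by (rule moduleI, rule K.is_cring, rule abelian_groupI)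
      (auto simp: base_space_def K.a_ac K.l_distr K.r_distr K.m_assoc intro: bexI[of _ "\<ominus>\<^bsub>K\<^esub> _"] K.l_neg)
qed

lemma Hom_space_module:
  assumes "module K M" "module K N"
  shows "module K (Hom_space K M N)"
proof -
  interpret M: module K M by fact
  interpret N: module K N by fact
  let ?H = "Hom_space K M N"
  have c: "f x \<in> carrier N" if "f \<in> carrier ?H" "x \<in> carrier M" for f x
    using that by (auto simp: Hom_space_def dest: linear_mapsD)
  have l: "f \<in> linear_maps K M N" "f \<in> extensional (carrier M)" if "f \<in> carrier ?H" for f
    using that by (auto simp: Hom_space_def)
  have I: "(\<lambda>x\<in>carrier M. f x) \<in> carrier ?H" if "f \<in> linear_maps K M N" for f
    using that by (auto simp: Hom_space_def linear_maps_def)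
  have ext: "f = h" if "f \<in> extensional (carrier M)" "h \<in> extensional (carrier M)"
    "\<And>x. x \<in> carrier M \<Longrightarrow> f x = h x" for f h :: "'b \<Rightarrow> 'c"
    using that by (rule extensionalityI)
  have ac: "f \<oplus>\<^bsub>?H\<^esub> h \<in> carrier ?H" if f: "f \<in> carrier ?H" and h: "h \<in> carrier ?H" for f h
  proof -
    have "(\<lambda>x. f x \<oplus>\<^bsub>N\<^esub> h x) \<in> linear_maps K M N"
      by (rule linear_mapsI) (use c[OF f] c[OF h] in
        \<open>auto simp: linear_mapsD[OF l(1)[OF f]] linear_mapsD[OF l(1)[OF h]] N.a_ac N.smult_r_distr\<close>)
    from I[OF this] show ?thesis by (simp add: Hom_space_def)
  qed
  have sc: "k \<odot>\<^bsub>?H\<^esub> f \<in> carrier ?H" if f: "f \<in> carrier ?H" and k: "k \<in> carrier K" for f k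
  proof -
    have "(\<lambda>x. k \<odot>\<^bsub>N\<^esub> f x) \<in> linear_maps K M N"
      by (rule linear_mapsI) (use c[OF f] k in
        \<open>auto simp: linear_mapsD[OF l(1)[OF f]] N.smult_r_distr N.smult_assoc1[symmetric] M.R.m_comm\<close>)
    from I[OF this] show ?thesis by (simp add: Hom_space_def)
  qed
  have zc: "\<zero>\<^bsub>?H\<^esub> \<in> carrier ?H"
    using I[of "\<lambda>_. \<zero>\<^bsub>N\<^esub>"] by (simp add: Hom_space_def linear_maps_def)
  show ?thesis
  proof (rule moduleI)
    show "cring K" by (rule M.R.is_cring)
    show "abelian_group ?H"
    proof (rule abelian_groupI)
      fix f assume f: "f \<in> carrier ?H"
      show "\<exists>h\<in>carrier ?H. h \<oplus>\<^bsub>?H\<^esub> f = \<zero>\<^bsub>?H\<^esub>"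
      \<comment> \<open>The negative is taken to be the scalar multiple by minus one, so that its
        membership in the carrier is the closure under scalars proved above.\<close>
      proof (rule bexI)
        show "(\<ominus>\<^bsub>K\<^esub> \<one>\<^bsub>K\<^esub>) \<odot>\<^bsub>?H\<^esub> f \<in> carrier ?H" using f sc by simp
        show "((\<ominus>\<^bsub>K\<^esub> \<one>\<^bsub>K\<^esub>) \<odot>\<^bsub>?H\<^esub> f) \<oplus>\<^bsub>?H\<^esub> f = \<zero>\<^bsub>?H\<^esub>"
          using c[OF f] by (auto simp: Hom_space_def N.smult_l_minus N.l_neg intro!: restrict_ext)
      qed
      show "\<zero>\<^bsub>?H\<^esub> \<oplus>\<^bsub>?H\<^esub> f = f"
        using c[OF f] l(2)[OF f] by (intro ext) (auto simp: Hom_space_def)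
    qed (use c ac zc in \<open>auto simp: Hom_space_def N.a_ac intro!: restrict_ext\<close>)
  next
    show "\<one>\<^bsub>K\<^esub> \<odot>\<^bsub>?H\<^esub> f = f" if f: "f \<in> carrier ?H" for f
      using c[OF f] l(2)[OF f] by (intro ext) (auto simp: Hom_space_def)
  qed (use c sc in \<open>auto simp: Hom_space_def N.smult_l_distr N.smult_r_distr N.smult_assoc1 intro!: restrict_ext\<close>)
qed

text \<open>By duality, \<open>g j\<close> kills every term of the basis expansion of
  \<open>y\<close> except the \<open>j\<close>-th, so the coefficients of \<open>y\<close> can only
  be the values \<open>g i y\<close>.\<close>

lemma dual_bases_expand:
  assumes "field K" "module K M" and d: "dual_bases K M I e g"
  shows "finite I" and "i \<in> I \<Longrightarrow> e i \<in> carrier M"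
    and "i \<in> I \<Longrightarrow> g i \<in> linear_maps K M (base_space K)"
    and "y \<in> carrier M \<Longrightarrow> y = (\<Oplus>\<^bsub>M\<^esub>i\<in>I. g i y \<odot>\<^bsub>M\<^esub> e i)"
proof -
  interpret M: module K M by fact
  interpret B: module K "base_space K" by (rule base_space_module) fact
  show fin: "finite I" using d by (simp add: dual_bases_def is_basis_def)
  show e: "e i \<in> carrier M" if "i \<in> I" for i
    using d that by (auto simp: dual_bases_def is_basis_def)
  show g: "g i \<in> linear_maps K M (base_space K)" if "i \<in> I" for i
    using d that by (auto simp: dual_bases_def is_basis_def Hom_space_def)
  have ge: "g i (e j) = (if i = j then \<one>\<^bsub>K\<^esub> else \<zero>\<^bsub>K\<^esub>)" if "i \<in> I" "j \<in> I" for i j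
    using d that by (simp add: dual_bases_def)
  assume "y \<in> carrier M"
  then obtain c where c: "c \<in> I \<rightarrow>\<^sub>E carrier K" and y: "y = (\<Oplus>\<^bsub>M\<^esub>i\<in>I. c i \<odot>\<^bsub>M\<^esub> e i)"
    using d unfolding dual_bases_def is_basis_def by blast
  have cK: "c i \<in> carrier K" if "i \<in> I" for i using c that by auto
  have ce: "(\<lambda>i. c i \<odot>\<^bsub>M\<^esub> e i) \<in> I \<rightarrow> carrier M" using cK e by auto
  have "g j y = c j" if j: "j \<in> I" for j
  proof -
    have "g j y = (\<Oplus>\<^bsub>base_space K\<^esub>i\<in>I. g j (c i \<odot>\<^bsub>M\<^esub> e i))"
      unfolding y by (rule linear_finsum[OF M.module_axioms B.module_axioms g[OF j] fin ce])
    \<comment> \<open>The default is written as the zero of \<open>base_space K\<close>, where the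
      sum is formed, to match the rule for a sum with a single nonzero term.\<close>
    also have "\<dots> = (\<Oplus>\<^bsub>base_space K\<^esub>i\<in>I. if j = i then c i else \<zero>\<^bsub>base_space K\<^esub>)"
      by (rule B.finsum_cong')
        (use cK e ge j in \<open>auto simp: linear_mapsD[OF g[OF j]] base_space_def\<close>)
    also have "\<dots> = c j"
      using B.add.finprod_singleton[OF j fin, of c] cK by (auto simp: base_space_def)
    finally show ?thesis .
  qed
  then show "y = (\<Oplus>\<^bsub>M\<^esub>i\<in>I. g i y \<odot>\<^bsub>M\<^esub> e i)"
    using y M.finsum_cong'[OF refl ce, of "\<lambda>i. g i y \<odot>\<^bsub>M\<^esub> e i"] by simp
qed

section \<open>Tensor products of linear maps\<close>

text \<open>The composite in which both \<open>induced_slice\<close> and the counit axiom of a right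
  comodule are phrased, so that results about slices apply to both.\<close>

definition tensor_slice ::
  "'k ring \<Rightarrow> ('k, 'a) module \<Rightarrow> ('k, 'b) module \<Rightarrow> ('b \<Rightarrow> 'k) \<Rightarrow> ('a \<times> 'b \<Rightarrow> 'k) set \<Rightarrow> 'a" where
  "tensor_slice K A B \<phi> t = tensor_runit K A (tensor_map K A B A (base_space K) (\<lambda>y. y) \<phi> t)"

locale ground_field =
  fixes K :: "'k ring"
  assumes field_K: "field K"
begin

lemmas tensor_module = tensor_module[OF field_K]
lemmas base_module = base_space_module[OF field_K]

lemma pure_tensor_linear:
  assumes "module K A" "module K B"
  shows "a \<in> carrier A \<Longrightarrow> pure_tensor K A B a \<in> linear_maps K B (tensor K A B)"
    and "b \<in> carrier B \<Longrightarrow> (\<lambda>a. pure_tensor K A B a b) \<in> linear_maps K A (tensor K A B)"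
  using pure_tensor_bilinear[OF field_K assms] by (auto simp: bilinear_map_def)

lemma pure_tensor_closed:
  assumes "module K A" "module K B" "a \<in> carrier A" "b \<in> carrier B"
  shows "pure_tensor K A B a b \<in> carrier (tensor K A B)"
  by (rule linear_mapsD(1)[OF pure_tensor_linear(1)[OF assms(1-3)] assms(4)])

lemma bilinear_mapI:
  assumes "\<And>a. a \<in> carrier A \<Longrightarrow> f a \<in> linear_maps K B P"
    and "\<And>b. b \<in> carrier B \<Longrightarrow> (\<lambda>a. f a b) \<in> linear_maps K A P"
  shows "bilinear_map K A B P f"
  using assms by (simp add: bilinear_map_def)

lemma lift_linear:
  assumes "module K A" "module K B" "module K P" "bilinear_map K A B P f"
  shows "tensor_lift K A B P f \<in> linear_maps K (tensor K A B) P"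
  using tensor_lift(1)[OF field_K assms] by (simp add: Hom_space_def)

lemmas lift_pure = tensor_lift(2)[OF field_K]

text \<open>The uniqueness half of the universal property, for the bilinear map that
  \<open>h\<close> induces on pure tensors. Uniqueness holds among extensional maps, hence both maps
  are first restricted to the carrier. Later identities between maps on tensor products are reduced
  to pure tensors in this way.\<close>

lemma tensor_ext:
  assumes A: "module K A" and B: "module K B" and P: "module K P"
    and h: "h \<in> linear_maps K (tensor K A B) P" and h': "h' \<in> linear_maps K (tensor K A B) P"
    and eq: "\<And>a b. \<lbrakk>a \<in> carrier A; b \<in> carrier B\<rbrakk> \<Longrightarrow>
      h (pure_tensor K A B a b) = h' (pure_tensor K A B a b)"
    and t: "t \<in> carrier (tensor K A B)"
  shows "h t = h' t"
proof -
  let ?T = "tensor K A B"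
  interpret T: module K ?T by (rule tensor_module[OF A B])
  define f where "f a b = h (pure_tensor K A B a b)" for a b
  have f: "bilinear_map K A B P f"
    unfolding f_def by (intro bilinear_mapI linear_comp[OF _ h] pure_tensor_linear[OF A B])
  have mem: "restrict k (carrier ?T) \<in> carrier (Hom_space K ?T P)"
    if "k \<in> linear_maps K ?T P" for k
    using that by (auto simp: Hom_space_def linear_maps_def)
  have "restrict h (carrier ?T) = restrict h' (carrier ?T)"
    by (rule Uniq_D[OF conjunct2[OF iffD1[OF ex1_iff_ex_Uniq tensor_universal[OF field_K A B P f]]]])
      (use mem[OF h] mem[OF h'] eq pure_tensor_closed[OF A B] in \<open>auto simp: f_def\<close>)
  then show ?thesis using t by (metis restrict_apply')
qed

text \<open>For fixed \<open>c\<close> the map sending \<open>s\<close> to \<open>s (x) c\<close> is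
  linear on \<open>A (x) B\<close>, so a second use of \<open>tensor_ext\<close> makes the first
  factor pure as well.\<close>

lemma tensor_ext3:
  assumes M: "module K A" "module K B" "module K C" "module K P"
    and h: "h \<in> linear_maps K (tensor K (tensor K A B) C) P"
    and h': "h' \<in> linear_maps K (tensor K (tensor K A B) C) P"
    and eq: "\<And>a b c. \<lbrakk>a \<in> carrier A; b \<in> carrier B; c \<in> carrier C\<rbrakk> \<Longrightarrow>
      h (pure_tensor K (tensor K A B) C (pure_tensor K A B a b) c) =
      h' (pure_tensor K (tensor K A B) C (pure_tensor K A B a b) c)"
    and t: "t \<in> carrier (tensor K (tensor K A B) C)"
  shows "h t = h' t"
proof (rule tensor_ext[OF tensor_module[OF M(1,2)] M(3,4) h h' _ t])
  fix s c assume s: "s \<in> carrier (tensor K A B)" and c: "c \<in> carrier C"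
  note l = pure_tensor_linear(2)[OF tensor_module[OF M(1,2)] M(3) c]
  show "h (pure_tensor K (tensor K A B) C s c) = h' (pure_tensor K (tensor K A B) C s c)"
    by (rule tensor_ext[OF M(1,2,4) linear_comp[OF l h] linear_comp[OF l h'] eq[OF _ _ c] s])
qed

lemma tensor_map:
  assumes "module K A" "module K B" "module K A'" "module K B'"
    and f: "f \<in> linear_maps K A A'" and g: "g \<in> linear_maps K B B'"
  shows tensor_map_linear: "tensor_map K A B A' B' f g \<in> linear_maps K (tensor K A B) (tensor K A' B')"
    and tensor_map_pure: "\<lbrakk>a \<in> carrier A; b \<in> carrier B\<rbrakk> \<Longrightarrow>
      tensor_map K A B A' B' f g (pure_tensor K A B a b) = pure_tensor K A' B' (f a) (g b)"
proof -
  have b: "bilinear_map K A B (tensor K A' B') (\<lambda>a b. pure_tensor K A' B' (f a) (g b))"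
    by (intro bilinear_mapI linear_comp[OF f pure_tensor_linear(2)]
        linear_comp[OF g pure_tensor_linear(1)] linear_mapsD(1)[OF f] linear_mapsD(1)[OF g] assms)
  show "tensor_map K A B A' B' f g \<in> linear_maps K (tensor K A B) (tensor K A' B')"
    unfolding tensor_map_def by (intro lift_linear tensor_module b assms)
  show "tensor_map K A B A' B' f g (pure_tensor K A B a b) = pure_tensor K A' B' (f a) (g b)"
    if "a \<in> carrier A" "b \<in> carrier B"
    unfolding tensor_map_def by (intro lift_pure tensor_module b assms that)
qed

text \<open>Maps that agree on carriers may still differ as HOL functions. This is what allows the
  extensional function \<open>induced_slice\<close> to replace a composite that is not cut off
  outside \<open>V_1\<close>.\<close>

lemma tensor_map_cong:
  assumes M: "module K A" "module K B" "module K A'" "module K B'"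
    and f: "f \<in> linear_maps K A A'" "f' \<in> linear_maps K A A'"
    and g: "g \<in> linear_maps K B B'" "g' \<in> linear_maps K B B'"
    and "\<And>a. a \<in> carrier A \<Longrightarrow> f a = f' a" "\<And>b. b \<in> carrier B \<Longrightarrow> g b = g' b"
    and t: "t \<in> carrier (tensor K A B)"
  shows "tensor_map K A B A' B' f g t = tensor_map K A B A' B' f' g' t"
  by (rule tensor_ext[OF M(1,2) tensor_module[OF M(3,4)] tensor_map_linear[OF M f(1) g(1)]
        tensor_map_linear[OF M f(2) g(2)] _ t])
    (simp add: tensor_map_pure[OF M f(1) g(1)] tensor_map_pure[OF M f(2) g(2)] assms)

lemma tensor_map_comp:
  assumes M: "module K A" "module K B" and M': "module K A'" "module K B'"
    and M'': "module K A''" "module K B''"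
    and f: "f \<in> linear_maps K A A'" and g: "g \<in> linear_maps K B B'"
    and f': "f' \<in> linear_maps K A' A''" and g': "g' \<in> linear_maps K B' B''"
    and t: "t \<in> carrier (tensor K A B)"
  shows "tensor_map K A' B' A'' B'' f' g' (tensor_map K A B A' B' f g t) =
    tensor_map K A B A'' B'' (\<lambda>a. f' (f a)) (\<lambda>b. g' (g b)) t"
  by (rule tensor_ext[OF M tensor_module[OF M'']
        linear_comp[OF tensor_map_linear[OF M M' f g] tensor_map_linear[OF M' M'' f' g']]
        tensor_map_linear[OF M M'' linear_comp[OF f f'] linear_comp[OF g g']] _ t])
    (simp add: tensor_map_pure[OF M M' f g] tensor_map_pure[OF M' M'' f' g']
      tensor_map_pure[OF M M'' linear_comp[OF f f'] linear_comp[OF g g']]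
      linear_mapsD(1)[OF f] linear_mapsD(1)[OF g])

text \<open>The map \<open>F\<close> occurs inside a tensor map on the right of the equation that
  defines \<open>W\<close>. Linearity in \<open>F\<close> is what makes that equation cut out a
  subspace of the Hom space.\<close>

lemma tensor_map_linear_in_map:
  assumes M: "module K A" "module K B" "module K B'" and t: "t \<in> carrier (tensor K A B)"
  shows "(\<lambda>F. tensor_map K A B A B' (\<lambda>y. y) F t) \<in> linear_maps K (Hom_space K B B') (tensor K A B')"
proof -
  interpret B: module K B by fact
  interpret H: module K "Hom_space K B B'" by (rule Hom_space_module[OF M(2,3)])
  interpret T: module K "tensor K A B'" by (rule tensor_module[OF M(1,3)])
  have l: "F \<in> linear_maps K B B'" if "F \<in> carrier (Hom_space K B B')" for F
    using that by (simp add: Hom_space_def)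
  note tm = tensor_map[OF M(1,2,1,3) linear_id l]
  show ?thesis
  proof (rule linear_mapsI)
    show "tensor_map K A B A B' (\<lambda>y. y) F t \<in> carrier (tensor K A B')"
      if "F \<in> carrier (Hom_space K B B')" for F
      using linear_mapsD(1)[OF tm(1)[OF that] t] .
  next
    fix F G assume F: "F \<in> carrier (Hom_space K B B')" and G: "G \<in> carrier (Hom_space K B B')"
    have FG: "F \<oplus>\<^bsub>Hom_space K B B'\<^esub> G \<in> carrier (Hom_space K B B')" using F G by simp
    \<comment> \<open>For fixed \<open>F\<close> and \<open>G\<close> both sides of the additivity
      claim are linear in \<open>t\<close>, so pure tensors suffice; there the claim is additivity
      of a pure tensor in its second slot.\<close>
    have "(\<lambda>t. tensor_map K A B A B' (\<lambda>y. y) F t \<oplus>\<^bsub>tensor K A B'\<^esub> tensor_map K A B A B' (\<lambda>y. y) G t)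
        \<in> linear_maps K (tensor K A B) (tensor K A B')"
      by (rule linear_mapsI)
        (auto simp: linear_mapsD[OF tm(1)[OF F]] linear_mapsD[OF tm(1)[OF G]] T.a_ac T.smult_r_distr)
    from tensor_ext[OF M(1,2) T.module_axioms tm(1)[OF FG] this _ t]
    show "tensor_map K A B A B' (\<lambda>y. y) (F \<oplus>\<^bsub>Hom_space K B B'\<^esub> G) t =
      tensor_map K A B A B' (\<lambda>y. y) F t \<oplus>\<^bsub>tensor K A B'\<^esub> tensor_map K A B A B' (\<lambda>y. y) G t"
      using linear_mapsD(1)[OF l[OF F]] linear_mapsD(1)[OF l[OF G]]
      by (simp add: tm(2)[OF F] tm(2)[OF G] tm(2)[OF FG])
        (simp add: Hom_space_def linear_mapsD(2)[OF pure_tensor_linear(1)[OF M(1,3)]])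
  next
    fix k F assume k: "k \<in> carrier K" and F: "F \<in> carrier (Hom_space K B B')"
    have kF: "k \<odot>\<^bsub>Hom_space K B B'\<^esub> F \<in> carrier (Hom_space K B B')" using k F by simp
    have "(\<lambda>t. k \<odot>\<^bsub>tensor K A B'\<^esub> tensor_map K A B A B' (\<lambda>y. y) F t)
        \<in> linear_maps K (tensor K A B) (tensor K A B')"
      by (rule linear_mapsI) (use k in
        \<open>auto simp: linear_mapsD[OF tm(1)[OF F]] T.smult_r_distr T.smult_assoc1[symmetric] B.R.m_comm\<close>)
    from tensor_ext[OF M(1,2) T.module_axioms tm(1)[OF kF] this _ t]
    show "tensor_map K A B A B' (\<lambda>y. y) (k \<odot>\<^bsub>Hom_space K B B'\<^esub> F) t =
      k \<odot>\<^bsub>tensor K A B'\<^esub> tensor_map K A B A B' (\<lambda>y. y) F t"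
      using linear_mapsD(1)[OF l[OF F]] k
      by (simp add: tm(2)[OF F] tm(2)[OF kF])
        (simp add: Hom_space_def linear_mapsD(3)[OF pure_tensor_linear(1)[OF M(1,3)]])
  qed
qed

section \<open>Slice maps, rebracketing and expansion along dual bases\<close>

lemma tensor_slice:
  assumes A: "module K A" and B: "module K B" and \<phi>: "\<phi> \<in> linear_maps K B (base_space K)"
  shows slice_linear: "tensor_slice K A B \<phi> \<in> linear_maps K (tensor K A B) A"
    and slice_pure: "\<lbrakk>a \<in> carrier A; b \<in> carrier B\<rbrakk> \<Longrightarrow>
      tensor_slice K A B \<phi> (pure_tensor K A B a b) = \<phi> b \<odot>\<^bsub>A\<^esub> a"
proof -
  interpret A: module K A by fact
  have b: "bilinear_map K A (base_space K) A (\<lambda>a k. k \<odot>\<^bsub>A\<^esub> a)"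
    by (intro bilinear_mapI linear_mapsI)
      (auto simp: base_space_def A.smult_l_distr A.smult_r_distr A.smult_assoc1[symmetric] A.R.m_comm)
  note tm = tensor_map[OF A B A base_module linear_id \<phi>]
  have s: "tensor_slice K A B \<phi> =
      (\<lambda>t. tensor_lift K A (base_space K) A (\<lambda>a k. k \<odot>\<^bsub>A\<^esub> a)
        (tensor_map K A B A (base_space K) (\<lambda>y. y) \<phi> t))"
    by (simp add: tensor_slice_def tensor_runit_def fun_eq_iff)
  show "tensor_slice K A B \<phi> \<in> linear_maps K (tensor K A B) A"
    unfolding s by (rule linear_comp[OF tm(1) lift_linear[OF A base_module A b]])
  show "tensor_slice K A B \<phi> (pure_tensor K A B a b) = \<phi> b \<odot>\<^bsub>A\<^esub> a"
    if "a \<in> carrier A" "b \<in> carrier B"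
    using that linear_mapsD(1)[OF \<phi>] by (simp add: s tm(2) lift_pure[OF A base_module A b])
qed

text \<open>The map is a lift of a lift. The outer lift requires the inner one,
  \<open>?g t c\<close>, to be linear in \<open>c\<close> for an arbitrary tensor \<open>t\<close>;
  since both sides of each such identity are linear in \<open>t\<close>, it is checked on pure
  tensors \<open>a (x) b\<close>.\<close>

lemma tensor_assoc:
  assumes A: "module K A" and B: "module K B" and C: "module K C"
  shows assoc_linear: "tensor_assoc K A B C \<in>
      linear_maps K (tensor K (tensor K A B) C) (tensor K A (tensor K B C))"
    and assoc_pure: "\<lbrakk>a \<in> carrier A; b \<in> carrier B; c \<in> carrier C\<rbrakk> \<Longrightarrow>
      tensor_assoc K A B C (pure_tensor K (tensor K A B) C (pure_tensor K A B a b) c) =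
      pure_tensor K A (tensor K B C) a (pure_tensor K B C b c)"
proof -
  let ?BC = "tensor K B C"
  let ?P = "tensor K A ?BC"
  let ?f = "\<lambda>c a b. pure_tensor K A ?BC a (pure_tensor K B C b c)"
  let ?g = "\<lambda>t c. tensor_lift K A B ?P (?f c) t"
  note BC = tensor_module[OF B C]
  note P = tensor_module[OF A BC]
  interpret P: module K ?P by (rule P)
  interpret A: module K A by fact
  have b: "bilinear_map K A B ?P (?f c)" if c: "c \<in> carrier C" for c
    by (intro bilinear_mapI pure_tensor_linear(2)[OF A BC] pure_tensor_closed[OF B C _ c]
      linear_comp[OF pure_tensor_linear(2)[OF B C c] pure_tensor_linear(1)[OF A BC]])
  note l = lift_linear[OF A B P b] and p = lift_pure[OF A B P b]
  have r: "?g t \<in> linear_maps K C ?P" if t: "t \<in> carrier (tensor K A B)" for t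
  proof (rule linear_mapsI)
    show "?g t c \<in> carrier ?P" if "c \<in> carrier C" for c
      using linear_mapsD(1)[OF l[OF that] t] .
  next
    interpret C: module K C by fact
    fix c d assume c: "c \<in> carrier C" and d: "d \<in> carrier C"
    have cd: "c \<oplus>\<^bsub>C\<^esub> d \<in> carrier C" using c d by simp
    have s: "(\<lambda>t. ?g t c \<oplus>\<^bsub>?P\<^esub> ?g t d) \<in> linear_maps K (tensor K A B) ?P"
      by (rule linear_mapsI)
        (auto simp: linear_mapsD[OF l[OF c]] linear_mapsD[OF l[OF d]] P.a_ac P.smult_r_distr)
    show "?g t (c \<oplus>\<^bsub>C\<^esub> d) = ?g t c \<oplus>\<^bsub>?P\<^esub> ?g t d"
      by (rule tensor_ext[OF A B P l[OF cd] s _ t])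
        (simp add: p c d linear_mapsD(2)[OF pure_tensor_linear(1)[OF B C]]
          linear_mapsD(2)[OF pure_tensor_linear(1)[OF A BC]] pure_tensor_closed[OF B C])
  next
    interpret C: module K C by fact
    fix k c assume k: "k \<in> carrier K" and c: "c \<in> carrier C"
    have kc: "k \<odot>\<^bsub>C\<^esub> c \<in> carrier C" using k c by simp
    have s: "(\<lambda>t. k \<odot>\<^bsub>?P\<^esub> ?g t c) \<in> linear_maps K (tensor K A B) ?P"
      by (rule linear_mapsI) (use k in
        \<open>auto simp: linear_mapsD[OF l[OF c]] P.smult_r_distr P.smult_assoc1[symmetric] P.R.m_comm\<close>)
    show "?g t (k \<odot>\<^bsub>C\<^esub> c) = k \<odot>\<^bsub>?P\<^esub> ?g t c"
      by (rule tensor_ext[OF A B P l[OF kc] s _ t])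
        (simp add: p c k linear_mapsD(3)[OF pure_tensor_linear(1)[OF B C]]
          linear_mapsD(3)[OF pure_tensor_linear(1)[OF A BC]] pure_tensor_closed[OF B C])
  qed
  have bb: "bilinear_map K (tensor K A B) C ?P ?g"
    by (rule bilinear_mapI) (use r l in auto)
  show "tensor_assoc K A B C \<in> linear_maps K (tensor K (tensor K A B) C) ?P"
    unfolding tensor_assoc_def by (rule lift_linear[OF tensor_module[OF A B] C P bb])
  show "tensor_assoc K A B C (pure_tensor K (tensor K A B) C (pure_tensor K A B a b) c) =
      pure_tensor K A (tensor K B C) a (pure_tensor K B C b c)"
    if "a \<in> carrier A" "b \<in> carrier B" "c \<in> carrier C"
    using that unfolding tensor_assoc_def
    by (simp add: lift_pure[OF tensor_module[OF A B] C P bb] pure_tensor_closed[OF A B] p)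
qed

text \<open>On \<open>(a (x) b) (x) c\<close> both sides equal \<open>\<psi> c\<close> times
  \<open>a (x) b\<close>: contracting the last factor does not see the bracketing. This removes
  \<open>tensor_assoc\<close> from the coassociativity laws.\<close>

lemma slice_assoc:
  assumes A: "module K A" and B: "module K B" and C: "module K C"
    and \<psi>: "\<psi> \<in> linear_maps K C (base_space K)" and u: "u \<in> carrier (tensor K (tensor K A B) C)"
  shows "tensor_map K A (tensor K B C) A B (\<lambda>y. y) (tensor_slice K B C \<psi>) (tensor_assoc K A B C u) =
    tensor_slice K (tensor K A B) C \<psi> u"
proof -
  note AB = tensor_module[OF A B] and BC = tensor_module[OF B C]
  note tm = tensor_map[OF A BC A B linear_id slice_linear[OF B C \<psi>]]
  note as = tensor_assoc[OF A B C]
  note sl = tensor_slice[OF AB C \<psi>]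
  have \<psi>K: "\<psi> c \<in> carrier K" if "c \<in> carrier C" for c
    using linear_mapsD(1)[OF \<psi> that] by (simp add: base_space_def)
  show ?thesis
    by (rule tensor_ext3[OF A B C AB linear_comp[OF as(1) tm(1)] sl(1) _ u])
      (simp add: as(2) tm(2) sl(2) pure_tensor_closed[OF A B] pure_tensor_closed[OF B C]
        slice_pure[OF B C \<psi>] \<psi>K linear_mapsD(3)[OF pure_tensor_linear(1)[OF A B]])
qed

text \<open>The two operations touch different factors, and linearity of \<open>f\<close> lets the
  scalar \<open>\<psi> c\<close> pass. It is applied with \<open>f\<close> a comultiplication, the
  coaction, and evaluation at a vector.\<close>

lemma slice_map_left:
  assumes A: "module K A" and A': "module K A'" and C: "module K C"
    and f: "f \<in> linear_maps K A A'" and \<psi>: "\<psi> \<in> linear_maps K C (base_space K)"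
    and u: "u \<in> carrier (tensor K A C)"
  shows "tensor_slice K A' C \<psi> (tensor_map K A C A' C f (\<lambda>y. y) u) = f (tensor_slice K A C \<psi> u)"
proof -
  note tm = tensor_map[OF A C A' C f linear_id]
  have \<psi>K: "\<psi> c \<in> carrier K" if "c \<in> carrier C" for c
    using linear_mapsD(1)[OF \<psi> that] by (simp add: base_space_def)
  show ?thesis
    by (rule tensor_ext[OF A C A' linear_comp[OF tm(1) slice_linear[OF A' C \<psi>]]
          linear_comp[OF slice_linear[OF A C \<psi>] f] _ u])
      (simp add: tm(2) slice_pure[OF A' C \<psi>] slice_pure[OF A C \<psi>] \<psi>K linear_mapsD[OF f])
qed

text \<open>Contraction after a map on the second factor is contraction by the pulled-back
  functional. Composite functionals such as \<open>(phi (x) psi) Delta\<close> arise from this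
  rule.\<close>

lemma slice_map_right:
  assumes A: "module K A" and B: "module K B" and B': "module K B'"
    and h: "h \<in> linear_maps K B B'" and \<phi>: "\<phi> \<in> linear_maps K B' (base_space K)"
    and s: "s \<in> carrier (tensor K A B)"
  shows "tensor_slice K A B' \<phi> (tensor_map K A B A B' (\<lambda>y. y) h s) =
    tensor_slice K A B (\<lambda>b. \<phi> (h b)) s"
proof -
  note tm = tensor_map[OF A B A B' linear_id h]
  note \<phi>h = linear_comp[OF h \<phi>]
  show ?thesis
    by (rule tensor_ext[OF A B A linear_comp[OF tm(1) slice_linear[OF A B' \<phi>]]
          slice_linear[OF A B \<phi>h] _ s])
      (simp add: tm(2) slice_pure[OF A B' \<phi>] slice_pure[OF A B \<phi>h] linear_mapsD(1)[OF h])
qed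

text \<open>Both sides are linear in \<open>t\<close>. For \<open>t = a (x) b\<close>, expand
  \<open>b\<close> along the dual basis and move the scalars \<open>g i b\<close> to the left
  factor. The coaction is defined by a sum of exactly this shape, with slices as left
  factors.\<close>

lemma tensor_expand:
  assumes A: "module K A" and B: "module K B" and d: "dual_bases K B I e g"
    and t: "t \<in> carrier (tensor K A B)"
  shows "t = (\<Oplus>\<^bsub>tensor K A B\<^esub>i\<in>I. pure_tensor K A B (tensor_slice K A B (g i) t) (e i))"
proof (rule tensor_ext[OF A B tensor_module[OF A B] linear_id _ _ t])
  note D = dual_bases_expand[OF field_K B d]
  interpret A: module K A by fact
  interpret B: module K B by fact
  interpret T: module K "tensor K A B" by (rule tensor_module[OF A B])
  show "(\<lambda>t. \<Oplus>\<^bsub>tensor K A B\<^esub>i\<in>I. pure_tensor K A B (tensor_slice K A B (g i) t) (e i))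
      \<in> linear_maps K (tensor K A B) (tensor K A B)"
    by (rule linear_sum_maps[OF T.module_axioms T.module_axioms D(1)])
      (rule linear_comp[OF slice_linear[OF A B D(3)] pure_tensor_linear(2)[OF A B D(2)]])
  fix a b assume a: "a \<in> carrier A" and b: "b \<in> carrier B"
  have gK: "g i b \<in> carrier K" if "i \<in> I" for i
    using linear_mapsD(1)[OF D(3)[OF that] b] by (simp add: base_space_def)
  note pl = pure_tensor_linear[OF A B]
  have ge: "(\<lambda>i. g i b \<odot>\<^bsub>B\<^esub> e i) \<in> I \<rightarrow> carrier B"
    using gK D(2) by auto
  have "pure_tensor K A B a b = (\<Oplus>\<^bsub>tensor K A B\<^esub>i\<in>I. pure_tensor K A B a (g i b \<odot>\<^bsub>B\<^esub> e i))"
    using linear_finsum[OF B T.module_axioms pl(1)[OF a] D(1) ge] D(4)[OF b] by simp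
  also have "\<dots> = (\<Oplus>\<^bsub>tensor K A B\<^esub>i\<in>I.
      pure_tensor K A B (tensor_slice K A B (g i) (pure_tensor K A B a b)) (e i))"
    by (rule T.finsum_cong')
      (use a b gK D(2,3) in \<open>auto simp: slice_pure[OF A B] linear_mapsD(3)[OF pl(1)]
        linear_mapsD(3)[OF pl(2)] pure_tensor_closed[OF A B]\<close>)
  finally show "pure_tensor K A B a b = \<dots>" .
qed

lemma tensor_eq_slices:
  assumes A: "module K A" and B: "module K B" and d: "dual_bases K B I e g"
    and s: "s \<in> carrier (tensor K A B)" and t: "t \<in> carrier (tensor K A B)"
    and eq: "\<And>i. i \<in> I \<Longrightarrow> tensor_slice K A B (g i) s = tensor_slice K A B (g i) t"
  shows "s = t"
proof -
  interpret T: module K "tensor K A B" by (rule tensor_module[OF A B])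
  note D = dual_bases_expand[OF field_K B d]
  have "(\<Oplus>\<^bsub>tensor K A B\<^esub>i\<in>I. pure_tensor K A B (tensor_slice K A B (g i) s) (e i)) =
      (\<Oplus>\<^bsub>tensor K A B\<^esub>i\<in>I. pure_tensor K A B (tensor_slice K A B (g i) t) (e i))"
    by (rule T.finsum_cong')
      (use eq t D(2) linear_mapsD(1)[OF slice_linear[OF A B D(3)]] in \<open>auto intro!: pure_tensor_closed[OF A B]\<close>)
  then show ?thesis
    using tensor_expand[OF A B d s] tensor_expand[OF A B d t] by simp
qed

text \<open>A threefold tensor is expanded along a dual basis of its last factor only. On
  \<open>a (x) r\<close> this is \<open>tensor_expand\<close> for \<open>r\<close> inside the second
  slot, followed by rebracketing, so no dual basis of \<open>B (x) C\<close> has to be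
  constructed.\<close>

lemma tensor_expand_assoc:
  assumes A: "module K A" and B: "module K B" and C: "module K C" and d: "dual_bases K C I e g"
    and t: "t \<in> carrier (tensor K A (tensor K B C))"
  shows "t = (\<Oplus>\<^bsub>tensor K A (tensor K B C)\<^esub>i\<in>I. tensor_assoc K A B C
    (pure_tensor K (tensor K A B) C
      (tensor_map K A (tensor K B C) A B (\<lambda>y. y) (tensor_slice K B C (g i)) t) (e i)))"
proof -
  note D = dual_bases_expand[OF field_K C d]
  note AB = tensor_module[OF A B] and BC = tensor_module[OF B C]
  note ABC = tensor_module[OF A BC]
  interpret T: module K "tensor K A (tensor K B C)" by (rule ABC)
  note tm = tensor_map[OF A BC A B linear_id slice_linear[OF B C D(3)]]
  note as = tensor_assoc[OF A B C]
  show ?thesis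
  proof (rule tensor_ext[OF A BC ABC linear_id _ _ t])
    show "(\<lambda>t. \<Oplus>\<^bsub>tensor K A (tensor K B C)\<^esub>i\<in>I. tensor_assoc K A B C
        (pure_tensor K (tensor K A B) C
          (tensor_map K A (tensor K B C) A B (\<lambda>y. y) (tensor_slice K B C (g i)) t) (e i)))
      \<in> linear_maps K (tensor K A (tensor K B C)) (tensor K A (tensor K B C))"
      by (rule linear_sum_maps[OF ABC ABC D(1)])
        (rule linear_comp[OF linear_comp[OF tm(1) pure_tensor_linear(2)[OF AB C D(2)]] as(1)])
    fix a r assume a: "a \<in> carrier A" and r: "r \<in> carrier (tensor K B C)"
    have sc: "tensor_slice K B C (g i) r \<in> carrier B" if "i \<in> I" for i
      by (rule linear_mapsD(1)[OF slice_linear[OF B C D(3)[OF that]] r])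
    have "pure_tensor K A (tensor K B C) a r = pure_tensor K A (tensor K B C) a
        (\<Oplus>\<^bsub>tensor K B C\<^esub>i\<in>I. pure_tensor K B C (tensor_slice K B C (g i) r) (e i))"
      using tensor_expand[OF B C d r] by simp
    also have "\<dots> = (\<Oplus>\<^bsub>tensor K A (tensor K B C)\<^esub>i\<in>I. pure_tensor K A (tensor K B C) a
        (pure_tensor K B C (tensor_slice K B C (g i) r) (e i)))"
      by (rule linear_finsum[OF BC ABC pure_tensor_linear(1)[OF A BC a] D(1)])
        (use sc D(2) pure_tensor_closed[OF B C] in auto)
    also have "\<dots> = (\<Oplus>\<^bsub>tensor K A (tensor K B C)\<^esub>i\<in>I. tensor_assoc K A B C
        (pure_tensor K (tensor K A B) C
          (tensor_map K A (tensor K B C) A B (\<lambda>y. y) (tensor_slice K B C (g i))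
            (pure_tensor K A (tensor K B C) a r)) (e i)))"
      by (rule T.finsum_cong')
        (use a r sc D(2) in \<open>auto simp: tm(2) as(2) intro!: pure_tensor_closed A B C BC\<close>)
    finally show "pure_tensor K A (tensor K B C) a r = \<dots>" .
  qed
qed

lemma tensor_eq_slices_assoc:
  assumes A: "module K A" and B: "module K B" and C: "module K C" and d: "dual_bases K C I e g"
    and s: "s \<in> carrier (tensor K A (tensor K B C))" and t: "t \<in> carrier (tensor K A (tensor K B C))"
    and eq: "\<And>i. i \<in> I \<Longrightarrow>
      tensor_map K A (tensor K B C) A B (\<lambda>y. y) (tensor_slice K B C (g i)) s =
      tensor_map K A (tensor K B C) A B (\<lambda>y. y) (tensor_slice K B C (g i)) t"
  shows "s = t"
proof -
  note D = dual_bases_expand[OF field_K C d]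
  note AB = tensor_module[OF A B] and BC = tensor_module[OF B C]
  interpret T: module K "tensor K A (tensor K B C)" by (rule tensor_module[OF A BC])
  note tm = tensor_map[OF A BC A B linear_id slice_linear[OF B C D(3)]]
  let ?f = "\<lambda>r i. tensor_assoc K A B C (pure_tensor K (tensor K A B) C
      (tensor_map K A (tensor K B C) A B (\<lambda>y. y) (tensor_slice K B C (g i)) r) (e i))"
  have "(\<Oplus>\<^bsub>tensor K A (tensor K B C)\<^esub>i\<in>I. ?f s i) = (\<Oplus>\<^bsub>tensor K A (tensor K B C)\<^esub>i\<in>I. ?f t i)"
    by (rule T.finsum_cong')
      (use eq t D(2) linear_mapsD(1)[OF tm(1)] in
        \<open>auto intro!: linear_mapsD(1)[OF assoc_linear[OF A B C]] pure_tensor_closed[OF AB C]\<close>)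
  then show ?thesis
    using tensor_expand_assoc[OF A B C d s] tensor_expand_assoc[OF A B C d t] by simp
qed

end

section \<open>The induced comodule\<close>

locale induced_comodule =
  left_pi_coisotropic_quantum_subgroup K \<pi> H \<Delta>\<^sub>H \<epsilon>\<^sub>H S C \<Delta>\<^sub>C \<epsilon>\<^sub>C act \<sigma> +
  V: left_pi_comodule K \<pi> C \<Delta>\<^sub>C \<epsilon>\<^sub>C V \<rho>
  for K :: "'k ring" and \<pi> :: "'g monoid"
    and H :: "'g \<Rightarrow> ('k, 'h) module"
    and \<Delta>\<^sub>H :: "'g \<Rightarrow> 'g \<Rightarrow> 'h \<Rightarrow> ('h \<times> 'h \<Rightarrow> 'k) set" and \<epsilon>\<^sub>H :: "'h \<Rightarrow> 'k"
    and S :: "'g \<Rightarrow> 'h \<Rightarrow> 'h"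
    and C :: "'g \<Rightarrow> ('k, 'c) module"
    and \<Delta>\<^sub>C :: "'g \<Rightarrow> 'g \<Rightarrow> 'c \<Rightarrow> ('c \<times> 'c \<Rightarrow> 'k) set" and \<epsilon>\<^sub>C :: "'c \<Rightarrow> 'k"
    and act :: "'g \<Rightarrow> 'h \<Rightarrow> 'c \<Rightarrow> 'c" and \<sigma> :: "'g \<Rightarrow> 'h \<Rightarrow> 'c"
    and V :: "'g \<Rightarrow> ('k, 'v) module" and \<rho> :: "'g \<Rightarrow> 'g \<Rightarrow> 'v \<Rightarrow> ('c \<times> 'v \<Rightarrow> 'k) set" +
  fixes J :: "'g \<Rightarrow> 'i set" and e :: "'g \<Rightarrow> 'i \<Rightarrow> 'h" and g :: "'g \<Rightarrow> 'i \<Rightarrow> 'h \<Rightarrow> 'k"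
  assumes bases: "\<beta> \<in> carrier \<pi> \<Longrightarrow> dual_bases K (H \<beta>) (J \<beta>) (e \<beta>) (g \<beta>)"
begin

sublocale ground_field K
  by (rule ground_field.intro[OF H.field_K])

sublocale \<pi>: group \<pi>
  by (rule H.group_pi)

abbreviation "U \<equiv> V \<one>\<^bsub>\<pi>\<^esub>"
abbreviation "W \<equiv> induced_W K \<pi> H \<Delta>\<^sub>H C \<sigma> V \<rho>"
abbreviation "slice \<equiv> induced_slice K \<pi> H \<Delta>\<^sub>H V"
abbreviation "\<Omega> \<equiv> induced_coaction K \<pi> H \<Delta>\<^sub>H C \<sigma> V \<rho> J e g"
abbreviation "dual \<beta> \<equiv> linear_maps K (H \<beta>) (base_space K)"

text \<open>On functions, \<open>slice\<close> is postcomposition with this map, by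
  \<open>slice_apply\<close>; the composition law for slices is therefore proved pointwise in
  \<open>H\<close>.\<close>

definition comult_slice :: "'g \<Rightarrow> 'g \<Rightarrow> ('h \<Rightarrow> 'k) \<Rightarrow> 'h \<Rightarrow> 'h" where
  "comult_slice \<alpha> \<beta> \<phi> x = tensor_slice K (H \<alpha>) (H \<beta>) \<phi> (\<Delta>\<^sub>H \<alpha> \<beta> x)"

lemmas U_module = V.comodule_space[OF \<pi>.one_closed]
lemmas C1_module = C.space[OF \<pi>.one_closed]

lemma slice_apply:
  "v \<in> carrier U \<Longrightarrow> slice \<alpha> \<beta> \<phi> F v = comult_slice \<alpha> \<beta> \<phi> (F v)"
  by (simp add: induced_slice_def comult_slice_def tensor_slice_def)

lemma comult_slice_linear:
  assumes "\<alpha> \<in> carrier \<pi>" "\<beta> \<in> carrier \<pi>" "\<phi> \<in> dual \<beta>"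
  shows "comult_slice \<alpha> \<beta> \<phi> \<in> linear_maps K (H (\<alpha> \<otimes>\<^bsub>\<pi>\<^esub> \<beta>)) (H \<alpha>)"
  using linear_comp[OF H.comult_linear slice_linear[OF H.space H.space]] assms
  by (simp add: comult_slice_def[abs_def])

text \<open>Coassociativity with its last factor contracted by \<open>\<psi>\<close>. On the left
  the contraction commutes with the comultiplication (\<open>slice_map_left\<close>); after
  rebracketing (\<open>slice_assoc\<close>) it meets the comultiplication of the second factor and
  fuses with it into \<open>comult_slice \<beta> \<gamma> \<psi>\<close>.\<close>

lemma comult_comult_slice:
  assumes a: "\<alpha> \<in> carrier \<pi>" and b: "\<beta> \<in> carrier \<pi>" and c: "\<gamma> \<in> carrier \<pi>"
    and \<psi>: "\<psi> \<in> dual \<gamma>" and x: "x \<in> carrier (H (\<alpha> \<otimes>\<^bsub>\<pi>\<^esub> \<beta> \<otimes>\<^bsub>\<pi>\<^esub> \<gamma>))"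
  shows "\<Delta>\<^sub>H \<alpha> \<beta> (comult_slice (\<alpha> \<otimes>\<^bsub>\<pi>\<^esub> \<beta>) \<gamma> \<psi> x) =
    tensor_map K (H \<alpha>) (H (\<beta> \<otimes>\<^bsub>\<pi>\<^esub> \<gamma>)) (H \<alpha>) (H \<beta>)
      (\<lambda>y. y) (comult_slice \<beta> \<gamma> \<psi>) (\<Delta>\<^sub>H \<alpha> (\<beta> \<otimes>\<^bsub>\<pi>\<^esub> \<gamma>) x)"
proof -
  have ab: "\<alpha> \<otimes>\<^bsub>\<pi>\<^esub> \<beta> \<in> carrier \<pi>" and bc: "\<beta> \<otimes>\<^bsub>\<pi>\<^esub> \<gamma> \<in> carrier \<pi>"
    using a b c by auto
  note A = H.space[OF a] and B = H.space[OF b] and C = H.space[OF c]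
    and AB = H.space[OF ab] and BC = H.space[OF bc]
  note D = H.comult_linear[OF a b] and D' = H.comult_linear[OF ab c]
  note TAB = tensor_module[OF A B] and TBC = tensor_module[OF B C]
  \<comment> \<open>The index of \<open>x\<close> is bracketed to the left; associativity in the
    group turns it into the one on which this comultiplication is defined.\<close>
  have x': "\<Delta>\<^sub>H \<alpha> (\<beta> \<otimes>\<^bsub>\<pi>\<^esub> \<gamma>) x \<in> carrier (tensor K (H \<alpha>) (H (\<beta> \<otimes>\<^bsub>\<pi>\<^esub> \<gamma>)))"
    using linear_mapsD(1)[OF H.comult_linear[OF a bc]] x by (simp add: \<pi>.m_assoc a b c)
  note x'' = linear_mapsD(1)[OF D' x]
  let ?u = "tensor_map K (H (\<alpha> \<otimes>\<^bsub>\<pi>\<^esub> \<beta>)) (H \<gamma>) (tensor K (H \<alpha>) (H \<beta>)) (H \<gamma>)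
    (\<Delta>\<^sub>H \<alpha> \<beta>) (\<lambda>y. y) (\<Delta>\<^sub>H (\<alpha> \<otimes>\<^bsub>\<pi>\<^esub> \<beta>) \<gamma> x)"
  have u: "?u \<in> carrier (tensor K (tensor K (H \<alpha>) (H \<beta>)) (H \<gamma>))"
    by (rule linear_mapsD(1)[OF tensor_map_linear[OF AB C TAB C D linear_id] x''])
  have "\<Delta>\<^sub>H \<alpha> \<beta> (comult_slice (\<alpha> \<otimes>\<^bsub>\<pi>\<^esub> \<beta>) \<gamma> \<psi> x) =
      tensor_slice K (tensor K (H \<alpha>) (H \<beta>)) (H \<gamma>) \<psi> ?u"
    unfolding comult_slice_def by (rule slice_map_left[OF AB TAB C D \<psi> x'', symmetric])
  also have "\<dots> = tensor_map K (H \<alpha>) (tensor K (H \<beta>) (H \<gamma>)) (H \<alpha>) (H \<beta>) (\<lambda>y. y)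
      (tensor_slice K (H \<beta>) (H \<gamma>) \<psi>) (tensor_assoc K (H \<alpha>) (H \<beta>) (H \<gamma>) ?u)"
    by (rule slice_assoc[OF A B C \<psi> u, symmetric])
  also have "\<dots> = tensor_map K (H \<alpha>) (H (\<beta> \<otimes>\<^bsub>\<pi>\<^esub> \<gamma>)) (H \<alpha>) (H \<beta>) (\<lambda>y. y)
      (\<lambda>y. tensor_slice K (H \<beta>) (H \<gamma>) \<psi> (\<Delta>\<^sub>H \<beta> \<gamma> y)) (\<Delta>\<^sub>H \<alpha> (\<beta> \<otimes>\<^bsub>\<pi>\<^esub> \<gamma>) x)"
    unfolding H.coassoc[OF a b c x]
    by (rule tensor_map_comp[OF A BC A TBC A B linear_id H.comult_linear[OF b c] linear_id
          slice_linear[OF B C \<psi>] x'])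
  finally show ?thesis by (simp add: comult_slice_def[abs_def])
qed

text \<open>Contract the second factor in \<open>comult_comult_slice\<close> by
  \<open>\<phi>\<close> and pull it back with \<open>slice_map_right\<close>. The functional on the
  right is \<open>(phi (x) psi) Delta\<close>, since contracting by \<open>psi\<close> first and
  applying \<open>phi\<close> afterwards multiplies the two values.\<close>

lemma comult_slice_comult_slice:
  assumes a: "\<alpha> \<in> carrier \<pi>" and b: "\<beta> \<in> carrier \<pi>" and c: "\<gamma> \<in> carrier \<pi>"
    and \<phi>: "\<phi> \<in> dual \<beta>" and \<psi>: "\<psi> \<in> dual \<gamma>"
    and x: "x \<in> carrier (H (\<alpha> \<otimes>\<^bsub>\<pi>\<^esub> \<beta> \<otimes>\<^bsub>\<pi>\<^esub> \<gamma>))"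
  shows "comult_slice \<alpha> \<beta> \<phi> (comult_slice (\<alpha> \<otimes>\<^bsub>\<pi>\<^esub> \<beta>) \<gamma> \<psi> x) =
    comult_slice \<alpha> (\<beta> \<otimes>\<^bsub>\<pi>\<^esub> \<gamma>) (\<lambda>y. \<phi> (comult_slice \<beta> \<gamma> \<psi> y)) x"
proof -
  have bc: "\<beta> \<otimes>\<^bsub>\<pi>\<^esub> \<gamma> \<in> carrier \<pi>" using b c by auto
  have x': "\<Delta>\<^sub>H \<alpha> (\<beta> \<otimes>\<^bsub>\<pi>\<^esub> \<gamma>) x \<in> carrier (tensor K (H \<alpha>) (H (\<beta> \<otimes>\<^bsub>\<pi>\<^esub> \<gamma>)))"
    using linear_mapsD(1)[OF H.comult_linear[OF a bc]] x by (simp add: \<pi>.m_assoc a b c)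
  show ?thesis
    unfolding comult_slice_def[of \<alpha>] comult_comult_slice[OF a b c \<psi> x]
    by (rule slice_map_right[OF H.space[OF a] H.space[OF bc] H.space[OF b]
          comult_slice_linear[OF b c \<psi>] \<phi> x'])
qed

section \<open>Slicing and the maps \<open>L\<close>\<close>

abbreviation "L \<equiv> induced_L K \<pi> H \<Delta>\<^sub>H C \<sigma>"

lemma L_linear:
  assumes a: "\<alpha> \<in> carrier \<pi>"
  shows "L \<alpha> \<in> linear_maps K (H \<alpha>) (tensor K (C \<one>\<^bsub>\<pi>\<^esub>) (H \<alpha>))"
proof -
  note o = \<pi>.one_closed
  show ?thesis
    using linear_comp[OF H.comult_linear[OF o a] tensor_map_linear[OF H.space[OF o] H.space[OF a]
        C1_module H.space[OF a] sigma_linear[OF o] linear_id]]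
    by (simp add: induced_L_def[abs_def] a)
qed

text \<open>Take the first index in \<open>comult_comult_slice\<close> to be the neutral element:
  \<open>sigma_1\<close> then acts on the first leg and the slice on the second. This identity is
  the reason why \<open>W\<close> is stable under slicing.\<close>

lemma L_comult_slice:
  assumes a: "\<alpha> \<in> carrier \<pi>" and b: "\<beta> \<in> carrier \<pi>" and \<phi>: "\<phi> \<in> dual \<beta>"
    and x: "x \<in> carrier (H (\<alpha> \<otimes>\<^bsub>\<pi>\<^esub> \<beta>))"
  shows "L \<alpha> (comult_slice \<alpha> \<beta> \<phi> x) =
    tensor_map K (C \<one>\<^bsub>\<pi>\<^esub>) (H (\<alpha> \<otimes>\<^bsub>\<pi>\<^esub> \<beta>)) (C \<one>\<^bsub>\<pi>\<^esub>) (H \<alpha>)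
      (\<lambda>y. y) (comult_slice \<alpha> \<beta> \<phi>) (L (\<alpha> \<otimes>\<^bsub>\<pi>\<^esub> \<beta>) x)"
proof -
  note o = \<pi>.one_closed
  have ab: "\<alpha> \<otimes>\<^bsub>\<pi>\<^esub> \<beta> \<in> carrier \<pi>" using a b by auto
  note A = H.space[OF a] and AB = H.space[OF ab] and E = H.space[OF o]
  note cs = comult_slice_linear[OF a b \<phi>]
  have x': "\<Delta>\<^sub>H \<one>\<^bsub>\<pi>\<^esub> (\<alpha> \<otimes>\<^bsub>\<pi>\<^esub> \<beta>) x \<in> carrier (tensor K (H \<one>\<^bsub>\<pi>\<^esub>) (H (\<alpha> \<otimes>\<^bsub>\<pi>\<^esub> \<beta>)))"
    using linear_mapsD(1)[OF H.comult_linear[OF o ab]] x ab by simp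
  have "\<Delta>\<^sub>H \<one>\<^bsub>\<pi>\<^esub> \<alpha> (comult_slice \<alpha> \<beta> \<phi> x) =
    tensor_map K (H \<one>\<^bsub>\<pi>\<^esub>) (H (\<alpha> \<otimes>\<^bsub>\<pi>\<^esub> \<beta>)) (H \<one>\<^bsub>\<pi>\<^esub>) (H \<alpha>)
      (\<lambda>y. y) (comult_slice \<alpha> \<beta> \<phi>) (\<Delta>\<^sub>H \<one>\<^bsub>\<pi>\<^esub> (\<alpha> \<otimes>\<^bsub>\<pi>\<^esub> \<beta>) x)"
    using comult_comult_slice[OF o a b \<phi>] x a by simp
  \<comment> \<open>In either order, \<open>sigma_1\<close> and the slice compose to the same tensor
    map, namely the one with \<open>sigma_1\<close> on the first factor and the slice on the
    second.\<close>
  then show ?thesis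
    by (simp add: induced_L_def
        tensor_map_comp[OF E AB E A C1_module A linear_id cs sigma_linear[OF o] linear_id x']
        tensor_map_comp[OF E AB C1_module AB C1_module A sigma_linear[OF o] linear_id linear_id cs x'])
qed

section \<open>The spaces \<open>W\<close> and their stability under slicing\<close>

lemma W_iff:
  "F \<in> carrier (W \<alpha>) \<longleftrightarrow> F \<in> carrier (Hom_space K U (H \<alpha>)) \<and> (\<forall>v\<in>carrier U.
    L \<alpha> (F v) = tensor_map K (C \<one>\<^bsub>\<pi>\<^esub>) U (C \<one>\<^bsub>\<pi>\<^esub>) (H \<alpha>) (\<lambda>y. y) F (\<rho> \<one>\<^bsub>\<pi>\<^esub> \<one>\<^bsub>\<pi>\<^esub> v))"
  by (simp add: induced_W_def)

lemma W_linear: "F \<in> carrier (W \<alpha>) \<Longrightarrow> F \<in> linear_maps K U (H \<alpha>)"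
  by (simp add: W_iff Hom_space_def)

lemma W_ext: "F \<in> carrier (W \<alpha>) \<Longrightarrow> F \<in> extensional (carrier U)"
  by (simp add: W_iff Hom_space_def)

lemma W_apply:
  assumes "v \<in> carrier U"
  shows "(F \<oplus>\<^bsub>W \<alpha>\<^esub> G) v = F v \<oplus>\<^bsub>H \<alpha>\<^esub> G v" and "(k \<odot>\<^bsub>W \<alpha>\<^esub> F) v = k \<odot>\<^bsub>H \<alpha>\<^esub> F v"
  using assms by (simp_all add: induced_W_def Hom_space_def)

text \<open>The defining condition is one linear equation in \<open>F\<close> for each
  \<open>v\<close>, so \<open>W \<alpha>\<close> is an intersection of equalizers \<open>E v\<close>
  inside the Hom space.\<close>

lemma W_module:
  assumes a: "\<alpha> \<in> carrier \<pi>"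
  shows "module K (W \<alpha>)"
proof -
  let ?N = "Hom_space K U (H \<alpha>)"
  note A = H.space[OF a]
  have N: "module K ?N" by (rule Hom_space_module[OF U_module A])
  interpret N: module K ?N by (rule N)
  have r: "\<rho> \<one>\<^bsub>\<pi>\<^esub> \<one>\<^bsub>\<pi>\<^esub> v \<in> carrier (tensor K (C \<one>\<^bsub>\<pi>\<^esub>) U)" if "v \<in> carrier U" for v
    using linear_mapsD(1)[OF V.coaction_linear[OF \<pi>.one_closed \<pi>.one_closed], of v] that by simp
  define E where "E v = {F \<in> carrier ?N. L \<alpha> (F v) =
      tensor_map K (C \<one>\<^bsub>\<pi>\<^esub>) U (C \<one>\<^bsub>\<pi>\<^esub>) (H \<alpha>) (\<lambda>y. y) F (\<rho> \<one>\<^bsub>\<pi>\<^esub> \<one>\<^bsub>\<pi>\<^esub> v)}" for v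
  have E: "submodule (E v) K ?N" if v: "v \<in> carrier U" for v
  proof -
    have ev: "(\<lambda>F. F v) \<in> linear_maps K ?N (H \<alpha>)"
      using v by (auto simp: Hom_space_def linear_maps_def)
    show ?thesis
      unfolding E_def
      by (rule linear_equalizer_submodule[OF N tensor_module[OF C1_module A]
            linear_comp[OF ev L_linear[OF a]]
            tensor_map_linear_in_map[OF C1_module U_module A r[OF v]]])
  qed
  have W: "carrier (W \<alpha>) = carrier ?N \<inter> (\<Inter>v\<in>carrier U. E v)"
    by (auto simp: W_iff E_def)
  have "submodule (carrier (W \<alpha>)) K ?N"
    by (rule N.submoduleI)
      (auto simp: W N.submoduleE[OF E] dest: subgroup.one_closed[OF submodule.axioms(1)[OF E]])
  then have "module K (?N\<lparr>carrier := carrier (W \<alpha>)\<rparr>)"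
    by (rule submodule.submodule_is_module[OF _ N])
  moreover have "?N\<lparr>carrier := carrier (W \<alpha>)\<rparr> = W \<alpha>" by (simp add: induced_W_def)
  ultimately show ?thesis by simp
qed

lemma W_eval_linear:
  assumes "v \<in> carrier U"
  shows "(\<lambda>F. F v) \<in> linear_maps K (W \<alpha>) (H \<alpha>)"
  by (rule linear_mapsI) (use assms in \<open>auto simp: W_apply dest: W_linear linear_mapsD(1)\<close>)

text \<open>Apply the slice to the second leg of the equation satisfied by \<open>F\<close>. On one
  side \<open>L_comult_slice\<close> moves it inside \<open>L\<close>; on the other, functoriality
  of the tensor product composes it with \<open>F\<close>.\<close>

lemma slice_closed:
  assumes a: "\<alpha> \<in> carrier \<pi>" and b: "\<beta> \<in> carrier \<pi>" and \<phi>: "\<phi> \<in> dual \<beta>"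
    and F: "F \<in> carrier (W (\<alpha> \<otimes>\<^bsub>\<pi>\<^esub> \<beta>))"
  shows "slice \<alpha> \<beta> \<phi> F \<in> carrier (W \<alpha>)"
proof -
  have ab: "\<alpha> \<otimes>\<^bsub>\<pi>\<^esub> \<beta> \<in> carrier \<pi>" using a b by auto
  note A = H.space[OF a] and AB = H.space[OF ab]
  note cs = comult_slice_linear[OF a b \<phi>] and Fl = W_linear[OF F]
  note sl = linear_comp[OF Fl cs]
  interpret U: module K U by (rule U_module)
  have sH: "slice \<alpha> \<beta> \<phi> F \<in> linear_maps K U (H \<alpha>)"
    by (rule linear_mapsI) (simp_all add: slice_apply linear_mapsD[OF sl])
  then have "slice \<alpha> \<beta> \<phi> F \<in> carrier (Hom_space K U (H \<alpha>))"
    by (simp add: Hom_space_def induced_slice_def)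
  moreover have "L \<alpha> (slice \<alpha> \<beta> \<phi> F v) =
      tensor_map K (C \<one>\<^bsub>\<pi>\<^esub>) U (C \<one>\<^bsub>\<pi>\<^esub>) (H \<alpha>) (\<lambda>y. y) (slice \<alpha> \<beta> \<phi> F) (\<rho> \<one>\<^bsub>\<pi>\<^esub> \<one>\<^bsub>\<pi>\<^esub> v)"
    if v: "v \<in> carrier U" for v
  proof -
    have r: "\<rho> \<one>\<^bsub>\<pi>\<^esub> \<one>\<^bsub>\<pi>\<^esub> v \<in> carrier (tensor K (C \<one>\<^bsub>\<pi>\<^esub>) U)"
      using linear_mapsD(1)[OF V.coaction_linear[OF \<pi>.one_closed \<pi>.one_closed], of v] v by simp
    have "L \<alpha> (slice \<alpha> \<beta> \<phi> F v) =
        tensor_map K (C \<one>\<^bsub>\<pi>\<^esub>) (H (\<alpha> \<otimes>\<^bsub>\<pi>\<^esub> \<beta>)) (C \<one>\<^bsub>\<pi>\<^esub>) (H \<alpha>)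
          (\<lambda>y. y) (comult_slice \<alpha> \<beta> \<phi>) (L (\<alpha> \<otimes>\<^bsub>\<pi>\<^esub> \<beta>) (F v))"
      using L_comult_slice[OF a b \<phi> linear_mapsD(1)[OF Fl v]] by (simp add: slice_apply v)
    also have "L (\<alpha> \<otimes>\<^bsub>\<pi>\<^esub> \<beta>) (F v) = tensor_map K (C \<one>\<^bsub>\<pi>\<^esub>) U (C \<one>\<^bsub>\<pi>\<^esub>) (H (\<alpha> \<otimes>\<^bsub>\<pi>\<^esub> \<beta>))
        (\<lambda>y. y) F (\<rho> \<one>\<^bsub>\<pi>\<^esub> \<one>\<^bsub>\<pi>\<^esub> v)"
      using F v by (simp add: W_iff)
    also have "tensor_map K (C \<one>\<^bsub>\<pi>\<^esub>) (H (\<alpha> \<otimes>\<^bsub>\<pi>\<^esub> \<beta>)) (C \<one>\<^bsub>\<pi>\<^esub>) (H \<alpha>)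
          (\<lambda>y. y) (comult_slice \<alpha> \<beta> \<phi>) \<dots> =
        tensor_map K (C \<one>\<^bsub>\<pi>\<^esub>) U (C \<one>\<^bsub>\<pi>\<^esub>) (H \<alpha>)
          (\<lambda>y. y) (\<lambda>v. comult_slice \<alpha> \<beta> \<phi> (F v)) (\<rho> \<one>\<^bsub>\<pi>\<^esub> \<one>\<^bsub>\<pi>\<^esub> v)"
      by (rule tensor_map_comp[OF C1_module U_module C1_module AB C1_module A
            linear_id Fl linear_id cs r])
    also have "\<dots> = tensor_map K (C \<one>\<^bsub>\<pi>\<^esub>) U (C \<one>\<^bsub>\<pi>\<^esub>) (H \<alpha>)
          (\<lambda>y. y) (slice \<alpha> \<beta> \<phi> F) (\<rho> \<one>\<^bsub>\<pi>\<^esub> \<one>\<^bsub>\<pi>\<^esub> v)"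
      by (rule tensor_map_cong[OF C1_module U_module C1_module A linear_id linear_id sl sH _ _ r])
        (simp_all add: slice_apply)
    finally show ?thesis .
  qed
  ultimately show ?thesis by (simp add: W_iff)
qed

lemma W_eqI:
  assumes "F \<in> carrier (W \<alpha>)" "G \<in> carrier (W \<alpha>)" "\<And>v. v \<in> carrier U \<Longrightarrow> F v = G v"
  shows "F = G"
  using assms W_ext by (blast intro: extensionalityI)

lemma slice_linear_W:
  assumes a: "\<alpha> \<in> carrier \<pi>" and b: "\<beta> \<in> carrier \<pi>" and \<phi>: "\<phi> \<in> dual \<beta>"
  shows "slice \<alpha> \<beta> \<phi> \<in> linear_maps K (W (\<alpha> \<otimes>\<^bsub>\<pi>\<^esub> \<beta>)) (W \<alpha>)"
proof -
  have ab: "\<alpha> \<otimes>\<^bsub>\<pi>\<^esub> \<beta> \<in> carrier \<pi>" using a b by auto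
  interpret W: module K "W \<alpha>" by (rule W_module[OF a])
  interpret W': module K "W (\<alpha> \<otimes>\<^bsub>\<pi>\<^esub> \<beta>)" by (rule W_module[OF ab])
  note cs = linear_mapsD[OF comult_slice_linear[OF a b \<phi>]] and sc = slice_closed[OF a b \<phi>]
  show ?thesis
    by (rule linear_mapsI, rule sc, assumption; rule W_eqI[of _ \<alpha>])
      (simp_all add: sc slice_apply W_apply cs linear_mapsD(1)[OF W_linear])
qed

section \<open>The coaction and its comodule axioms\<close>

lemma coaction_eq:
  "\<Omega> \<alpha> \<beta> F = (\<Oplus>\<^bsub>tensor K (W \<alpha>) (H \<beta>)\<^esub>i\<in>J \<beta>.
    pure_tensor K (W \<alpha>) (H \<beta>) (slice \<alpha> \<beta> (g \<beta> i) F) (e \<beta> i))"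
  by (simp add: induced_coaction_def Let_def)

lemma coaction_linear:
  assumes a: "\<alpha> \<in> carrier \<pi>" and b: "\<beta> \<in> carrier \<pi>"
  shows "\<Omega> \<alpha> \<beta> \<in> linear_maps K (W (\<alpha> \<otimes>\<^bsub>\<pi>\<^esub> \<beta>)) (tensor K (W \<alpha>) (H \<beta>))"
proof -
  note D = dual_bases_expand[OF field_K H.space[OF b] bases[OF b]]
  have ab: "\<alpha> \<otimes>\<^bsub>\<pi>\<^esub> \<beta> \<in> carrier \<pi>" using a b by auto
  show ?thesis
    unfolding coaction_eq[abs_def]
    by (rule linear_sum_maps[OF W_module[OF ab] tensor_module[OF W_module[OF a] H.space[OF b]] D(1)])
      (rule linear_comp[OF slice_linear_W[OF a b D(3)]
          pure_tensor_linear(2)[OF W_module[OF a] H.space[OF b] D(2)]])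
qed

text \<open>Evaluation at \<open>v\<close> in the first factor sends \<open>\<Omega> F\<close> to \<open>\<Delta>\<^sub>H (F v)\<close>, so \<open>\<Omega>\<close> inherits its
  properties from the comultiplication.\<close>

lemma eval_coaction:
  assumes a: "\<alpha> \<in> carrier \<pi>" and b: "\<beta> \<in> carrier \<pi>"
    and F: "F \<in> carrier (W (\<alpha> \<otimes>\<^bsub>\<pi>\<^esub> \<beta>))" and v: "v \<in> carrier U"
  shows "tensor_map K (W \<alpha>) (H \<beta>) (H \<alpha>) (H \<beta>) (\<lambda>G. G v) (\<lambda>y. y) (\<Omega> \<alpha> \<beta> F) = \<Delta>\<^sub>H \<alpha> \<beta> (F v)"
proof -
  note A = H.space[OF a] and B = H.space[OF b] and WA = W_module[OF a]
  note D = dual_bases_expand[OF field_K B bases[OF b]]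
  note tm = tensor_map[OF WA B A B W_eval_linear[OF v] linear_id]
  note sc = slice_closed[OF a b D(3) F]
  interpret T: module K "tensor K (H \<alpha>) (H \<beta>)" by (rule tensor_module[OF A B])
  have F': "\<Delta>\<^sub>H \<alpha> \<beta> (F v) \<in> carrier (tensor K (H \<alpha>) (H \<beta>))"
    by (rule linear_mapsD(1)[OF H.comult_linear[OF a b] linear_mapsD(1)[OF W_linear[OF F] v]])
  have "tensor_map K (W \<alpha>) (H \<beta>) (H \<alpha>) (H \<beta>) (\<lambda>G. G v) (\<lambda>y. y) (\<Omega> \<alpha> \<beta> F) =
    (\<Oplus>\<^bsub>tensor K (H \<alpha>) (H \<beta>)\<^esub>i\<in>J \<beta>. tensor_map K (W \<alpha>) (H \<beta>) (H \<alpha>) (H \<beta>) (\<lambda>G. G v) (\<lambda>y. y)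
      (pure_tensor K (W \<alpha>) (H \<beta>) (slice \<alpha> \<beta> (g \<beta> i) F) (e \<beta> i)))"
    unfolding coaction_eq
    by (rule linear_finsum[OF tensor_module[OF WA B] T.module_axioms tm(1) D(1)])
      (use sc D(2) pure_tensor_closed[OF WA B] in auto)
  \<comment> \<open>Evaluation turns the coefficient
    \<open>slice \<alpha> \<beta> (g \<beta> i) F\<close> into the slice of
    \<open>\<Delta>\<^sub>H \<alpha> \<beta> (F v)\<close>, so the sum is the dual basis expansion
    of that tensor.\<close>
  also have "\<dots> = (\<Oplus>\<^bsub>tensor K (H \<alpha>) (H \<beta>)\<^esub>i\<in>J \<beta>. pure_tensor K (H \<alpha>) (H \<beta>)
      (tensor_slice K (H \<alpha>) (H \<beta>) (g \<beta> i) (\<Delta>\<^sub>H \<alpha> \<beta> (F v))) (e \<beta> i))"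
    by (rule T.finsum_cong')
      (use sc v F' D(2) linear_mapsD(1)[OF slice_linear[OF A B D(3)]] pure_tensor_closed[OF A B]
        in \<open>auto simp: tm(2) slice_apply comult_slice_def\<close>)
  also have "\<dots> = \<Delta>\<^sub>H \<alpha> \<beta> (F v)"
    by (rule tensor_expand[OF A B bases[OF b] F', symmetric])
  finally show ?thesis .
qed

text \<open>Evaluation at \<open>v\<close> commutes with the contraction, and
  \<open>eval_coaction\<close> then gives the comultiplication. The functional is arbitrary rather
  than a basis functional because the counit and composite functionals are inserted later.\<close>

lemma slice_coaction:
  assumes a: "\<alpha> \<in> carrier \<pi>" and b: "\<beta> \<in> carrier \<pi>" and \<phi>: "\<phi> \<in> dual \<beta>"
    and F: "F \<in> carrier (W (\<alpha> \<otimes>\<^bsub>\<pi>\<^esub> \<beta>))"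
  shows "tensor_slice K (W \<alpha>) (H \<beta>) \<phi> (\<Omega> \<alpha> \<beta> F) = slice \<alpha> \<beta> \<phi> F"
proof (rule W_eqI)
  note A = H.space[OF a] and B = H.space[OF b] and WA = W_module[OF a]
  note \<Omega>F = linear_mapsD(1)[OF coaction_linear[OF a b] F]
  show "tensor_slice K (W \<alpha>) (H \<beta>) \<phi> (\<Omega> \<alpha> \<beta> F) \<in> carrier (W \<alpha>)"
    by (rule linear_mapsD(1)[OF slice_linear[OF WA B \<phi>] \<Omega>F])
  show "slice \<alpha> \<beta> \<phi> F \<in> carrier (W \<alpha>)" by (rule slice_closed[OF a b \<phi> F])
  show "tensor_slice K (W \<alpha>) (H \<beta>) \<phi> (\<Omega> \<alpha> \<beta> F) v = slice \<alpha> \<beta> \<phi> F v" if v: "v \<in> carrier U" for v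
    using slice_map_left[OF WA A B W_eval_linear[OF v] \<phi> \<Omega>F] eval_coaction[OF a b F v]
    by (simp add: slice_apply v comult_slice_def)
qed

text \<open>Contracting \<open>H \<gamma>\<close> by \<open>g \<gamma> k\<close> and then
  \<open>H \<beta>\<close> by \<open>g \<beta> i\<close> turns the left side into an iterated slice
  of \<open>F\<close> and the right side into the slice by the composite functional. These agree by
  \<open>comult_slice_comult_slice\<close>.\<close>

lemma coaction_coassoc:
  assumes a: "\<alpha> \<in> carrier \<pi>" and b: "\<beta> \<in> carrier \<pi>" and c: "\<gamma> \<in> carrier \<pi>"
    and F: "F \<in> carrier (W (\<alpha> \<otimes>\<^bsub>\<pi>\<^esub> \<beta> \<otimes>\<^bsub>\<pi>\<^esub> \<gamma>))"
  shows "tensor_assoc K (W \<alpha>) (H \<beta>) (H \<gamma>)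
      (tensor_map K (W (\<alpha> \<otimes>\<^bsub>\<pi>\<^esub> \<beta>)) (H \<gamma>) (tensor K (W \<alpha>) (H \<beta>)) (H \<gamma>)
        (\<Omega> \<alpha> \<beta>) (\<lambda>y. y) (\<Omega> (\<alpha> \<otimes>\<^bsub>\<pi>\<^esub> \<beta>) \<gamma> F)) =
    tensor_map K (W \<alpha>) (H (\<beta> \<otimes>\<^bsub>\<pi>\<^esub> \<gamma>)) (W \<alpha>) (tensor K (H \<beta>) (H \<gamma>))
      (\<lambda>y. y) (\<Delta>\<^sub>H \<beta> \<gamma>) (\<Omega> \<alpha> (\<beta> \<otimes>\<^bsub>\<pi>\<^esub> \<gamma>) F)" (is "?l = ?r")
proof -
  have ab: "\<alpha> \<otimes>\<^bsub>\<pi>\<^esub> \<beta> \<in> carrier \<pi>" and bc: "\<beta> \<otimes>\<^bsub>\<pi>\<^esub> \<gamma> \<in> carrier \<pi>"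
    using a b c by auto
  note A = H.space[OF a] and B = H.space[OF b] and C = H.space[OF c] and BC = H.space[OF bc]
    and WA = W_module[OF a] and WAB = W_module[OF ab]
  note TB = tensor_module[OF WA B] and TBC = tensor_module[OF B C]
  note \<Omega>ab = coaction_linear[OF a b]
  have F': "F \<in> carrier (W (\<alpha> \<otimes>\<^bsub>\<pi>\<^esub> (\<beta> \<otimes>\<^bsub>\<pi>\<^esub> \<gamma>)))" using F by (simp add: \<pi>.m_assoc a b c)
  note \<Omega>F = linear_mapsD(1)[OF coaction_linear[OF ab c] F]
  note \<Omega>F' = linear_mapsD(1)[OF coaction_linear[OF a bc] F']
  let ?u = "tensor_map K (W (\<alpha> \<otimes>\<^bsub>\<pi>\<^esub> \<beta>)) (H \<gamma>) (tensor K (W \<alpha>) (H \<beta>)) (H \<gamma>)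
        (\<Omega> \<alpha> \<beta>) (\<lambda>y. y) (\<Omega> (\<alpha> \<otimes>\<^bsub>\<pi>\<^esub> \<beta>) \<gamma> F)"
  have u: "?u \<in> carrier (tensor K (tensor K (W \<alpha>) (H \<beta>)) (H \<gamma>))"
    by (rule linear_mapsD(1)[OF tensor_map_linear[OF WAB C TB C \<Omega>ab linear_id] \<Omega>F])
  show ?thesis
  proof (rule tensor_eq_slices_assoc[OF WA B C bases[OF c]])
    show "?l \<in> carrier (tensor K (W \<alpha>) (tensor K (H \<beta>) (H \<gamma>)))"
      by (rule linear_mapsD(1)[OF assoc_linear[OF WA B C] u])
    show "?r \<in> carrier (tensor K (W \<alpha>) (tensor K (H \<beta>) (H \<gamma>)))"
      by (rule linear_mapsD(1)[OF tensor_map_linear[OF WA BC WA TBC linear_id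
              H.comult_linear[OF b c]] \<Omega>F'])
    fix k assume "k \<in> J \<gamma>"
    then have \<psi>: "g \<gamma> k \<in> dual \<gamma>" by (rule dual_bases_expand(3)[OF field_K C bases[OF c]])
    note sF = slice_closed[OF ab c \<psi> F]
    note cs = comult_slice_linear[OF b c \<psi>]
    \<comment> \<open>The contraction cancels the rebracketing and passes through the outer
      coaction, where it meets the inner one and leaves a slice of \<open>F\<close>.\<close>
    have l: "tensor_map K (W \<alpha>) (tensor K (H \<beta>) (H \<gamma>)) (W \<alpha>) (H \<beta>) (\<lambda>y. y)
        (tensor_slice K (H \<beta>) (H \<gamma>) (g \<gamma> k)) ?l = \<Omega> \<alpha> \<beta> (slice (\<alpha> \<otimes>\<^bsub>\<pi>\<^esub> \<beta>) \<gamma> (g \<gamma> k) F)"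
      by (simp add: slice_assoc[OF WA B C \<psi> u] slice_map_left[OF WAB TB C \<Omega>ab \<psi> \<Omega>F]
          slice_coaction[OF ab c \<psi> F])
    \<comment> \<open>Here the contraction merges with the comultiplication of the second factor, so
      only a map from \<open>H\<close> at the product index to \<open>H \<beta>\<close>
      remains.\<close>
    have r: "tensor_map K (W \<alpha>) (tensor K (H \<beta>) (H \<gamma>)) (W \<alpha>) (H \<beta>) (\<lambda>y. y)
        (tensor_slice K (H \<beta>) (H \<gamma>) (g \<gamma> k)) ?r =
      tensor_map K (W \<alpha>) (H (\<beta> \<otimes>\<^bsub>\<pi>\<^esub> \<gamma>)) (W \<alpha>) (H \<beta>) (\<lambda>y. y)
        (comult_slice \<beta> \<gamma> (g \<gamma> k)) (\<Omega> \<alpha> (\<beta> \<otimes>\<^bsub>\<pi>\<^esub> \<gamma>) F)"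
      using tensor_map_comp[OF WA BC WA TBC WA B linear_id H.comult_linear[OF b c] linear_id
          slice_linear[OF B C \<psi>] \<Omega>F'] by (simp add: comult_slice_def[abs_def])
    show "tensor_map K (W \<alpha>) (tensor K (H \<beta>) (H \<gamma>)) (W \<alpha>) (H \<beta>) (\<lambda>y. y)
        (tensor_slice K (H \<beta>) (H \<gamma>) (g \<gamma> k)) ?l =
      tensor_map K (W \<alpha>) (tensor K (H \<beta>) (H \<gamma>)) (W \<alpha>) (H \<beta>) (\<lambda>y. y)
        (tensor_slice K (H \<beta>) (H \<gamma>) (g \<gamma> k)) ?r"
      unfolding l r
    proof (rule tensor_eq_slices[OF WA B bases[OF b]])
      show "\<Omega> \<alpha> \<beta> (slice (\<alpha> \<otimes>\<^bsub>\<pi>\<^esub> \<beta>) \<gamma> (g \<gamma> k) F) \<in> carrier (tensor K (W \<alpha>) (H \<beta>))"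
        by (rule linear_mapsD(1)[OF \<Omega>ab sF])
      show "tensor_map K (W \<alpha>) (H (\<beta> \<otimes>\<^bsub>\<pi>\<^esub> \<gamma>)) (W \<alpha>) (H \<beta>) (\<lambda>y. y)
        (comult_slice \<beta> \<gamma> (g \<gamma> k)) (\<Omega> \<alpha> (\<beta> \<otimes>\<^bsub>\<pi>\<^esub> \<gamma>) F) \<in> carrier (tensor K (W \<alpha>) (H \<beta>))"
        by (rule linear_mapsD(1)[OF tensor_map_linear[OF WA BC WA B linear_id cs] \<Omega>F'])
      fix i assume "i \<in> J \<beta>"
      then have \<phi>: "g \<beta> i \<in> dual \<beta>" by (rule dual_bases_expand(3)[OF field_K B bases[OF b]])
      note \<phi>cs = linear_comp[OF cs \<phi>]
      have "slice \<alpha> \<beta> (g \<beta> i) (slice (\<alpha> \<otimes>\<^bsub>\<pi>\<^esub> \<beta>) \<gamma> (g \<gamma> k) F) =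
          slice \<alpha> (\<beta> \<otimes>\<^bsub>\<pi>\<^esub> \<gamma>) (\<lambda>y. g \<beta> i (comult_slice \<beta> \<gamma> (g \<gamma> k) y)) F"
        by (rule W_eqI[OF slice_closed[OF a b \<phi> sF] slice_closed[OF a bc \<phi>cs F']])
          (simp add: slice_apply
            comult_slice_comult_slice[OF a b c \<phi> \<psi> linear_mapsD(1)[OF W_linear[OF F]]])
      then show "tensor_slice K (W \<alpha>) (H \<beta>) (g \<beta> i) (\<Omega> \<alpha> \<beta> (slice (\<alpha> \<otimes>\<^bsub>\<pi>\<^esub> \<beta>) \<gamma> (g \<gamma> k) F)) =
        tensor_slice K (W \<alpha>) (H \<beta>) (g \<beta> i) (tensor_map K (W \<alpha>) (H (\<beta> \<otimes>\<^bsub>\<pi>\<^esub> \<gamma>)) (W \<alpha>) (H \<beta>)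
          (\<lambda>y. y) (comult_slice \<beta> \<gamma> (g \<gamma> k)) (\<Omega> \<alpha> (\<beta> \<otimes>\<^bsub>\<pi>\<^esub> \<gamma>) F))"
        by (simp add: slice_coaction[OF a b \<phi> sF] slice_map_right[OF WA BC B cs \<phi> \<Omega>F']
            slice_coaction[OF a bc \<phi>cs F'])
    qed
  qed
qed

text \<open>The counit is itself an admissible functional, so \<open>slice_coaction\<close> reduces
  the claim to the right counit law of \<open>H\<close> at each value \<open>F v\<close>.\<close>

lemma coaction_counit:
  assumes a: "\<alpha> \<in> carrier \<pi>" and F: "F \<in> carrier (W \<alpha>)"
  shows "tensor_slice K (W \<alpha>) (H \<one>\<^bsub>\<pi>\<^esub>) \<epsilon>\<^sub>H (\<Omega> \<alpha> \<one>\<^bsub>\<pi>\<^esub> F) = F"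
proof -
  have F': "F \<in> carrier (W (\<alpha> \<otimes>\<^bsub>\<pi>\<^esub> \<one>\<^bsub>\<pi>\<^esub>))" using F a by simp
  note s = slice_closed[OF a \<pi>.one_closed H.counit_linear F']
  have "slice \<alpha> \<one>\<^bsub>\<pi>\<^esub> \<epsilon>\<^sub>H F = F"
    by (rule W_eqI[OF s F])
      (simp add: slice_apply comult_slice_def tensor_slice_def
        H.counit_right[OF a linear_mapsD(1)[OF W_linear[OF F]]])
  then show ?thesis by (simp add: slice_coaction[OF a \<pi>.one_closed H.counit_linear F'])
qed

lemma induced_right_comodule: "right_pi_comodule K \<pi> H \<Delta>\<^sub>H \<epsilon>\<^sub>H W \<Omega>"
proof (intro right_pi_comodule.intro right_pi_comodule_axioms.intro)
  show "pi_coalgebra K \<pi> H \<Delta>\<^sub>H \<epsilon>\<^sub>H" by (rule H.pi_coalgebra_axioms)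
qed (simp_all add: W_module coaction_linear coaction_coassoc
    coaction_counit[unfolded tensor_slice_def])

end

text \<open>The first conjunct gives the coaction formula its intended meaning:
  \<open>pure_tensor\<close> is a total function, so it must be asserted that the left factors of
  the summands really lie in \<open>W\<close>.\<close>

theorem theorem4p3:
  fixes K :: "'k ring" and \<pi> :: "'g monoid"
    and H :: "'g \<Rightarrow> ('k, 'h) module"
    and \<Delta>\<^sub>H :: "'g \<Rightarrow> 'g \<Rightarrow> 'h \<Rightarrow> ('h \<times> 'h \<Rightarrow> 'k) set" and \<epsilon>\<^sub>H :: "'h \<Rightarrow> 'k"
    and S :: "'g \<Rightarrow> 'h \<Rightarrow> 'h"
    and C :: "'g \<Rightarrow> ('k, 'c) module"
    and \<Delta>\<^sub>C :: "'g \<Rightarrow> 'g \<Rightarrow> 'c \<Rightarrow> ('c \<times> 'c \<Rightarrow> 'k) set" and \<epsilon>\<^sub>C :: "'c \<Rightarrow> 'k"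
    and act :: "'g \<Rightarrow> 'h \<Rightarrow> 'c \<Rightarrow> 'c" and \<sigma> :: "'g \<Rightarrow> 'h \<Rightarrow> 'c"
    and V :: "'g \<Rightarrow> ('k, 'v) module" and \<rho> :: "'g \<Rightarrow> 'g \<Rightarrow> 'v \<Rightarrow> ('c \<times> 'v \<Rightarrow> 'k) set"
    and J :: "'g \<Rightarrow> 'i set" and e :: "'g \<Rightarrow> 'i \<Rightarrow> 'h" and g :: "'g \<Rightarrow> 'i \<Rightarrow> 'h \<Rightarrow> 'k"
  assumes hopf: "hopf_pi_coalgebra K \<pi> H \<Delta>\<^sub>H \<epsilon>\<^sub>H S"
    and fin: "\<And>\<alpha>. \<alpha> \<in> carrier \<pi> \<Longrightarrow> fin_dim K (H \<alpha>)"
    and coisotropic: "left_pi_coisotropic_quantum_subgroup K \<pi> H \<Delta>\<^sub>H \<epsilon>\<^sub>H S C \<Delta>\<^sub>C \<epsilon>\<^sub>C act \<sigma>"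
    and comodule: "left_pi_comodule K \<pi> C \<Delta>\<^sub>C \<epsilon>\<^sub>C V \<rho>"
    and bases: "\<And>\<beta>. \<beta> \<in> carrier \<pi> \<Longrightarrow> dual_bases K (H \<beta>) (J \<beta>) (e \<beta>) (g \<beta>)"
  shows "(\<forall>\<alpha>\<in>carrier \<pi>. \<forall>\<beta>\<in>carrier \<pi>.
            \<forall>F\<in>carrier (induced_W K \<pi> H \<Delta>\<^sub>H C \<sigma> V \<rho> (\<alpha> \<otimes>\<^bsub>\<pi>\<^esub> \<beta>)). \<forall>i\<in>J \<beta>.
            induced_slice K \<pi> H \<Delta>\<^sub>H V \<alpha> \<beta> (g \<beta> i) F \<in> carrier (induced_W K \<pi> H \<Delta>\<^sub>H C \<sigma> V \<rho> \<alpha>)) \<and>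
         right_pi_comodule K \<pi> H \<Delta>\<^sub>H \<epsilon>\<^sub>H (induced_W K \<pi> H \<Delta>\<^sub>H C \<sigma> V \<rho>)
           (induced_coaction K \<pi> H \<Delta>\<^sub>H C \<sigma> V \<rho> J e g)"
proof -
  interpret induced_comodule K \<pi> H \<Delta>\<^sub>H \<epsilon>\<^sub>H S C \<Delta>\<^sub>C \<epsilon>\<^sub>C act \<sigma> V \<rho> J e g
    by (intro induced_comodule.intro induced_comodule_axioms.intro coisotropic comodule bases)
  show ?thesis
    using slice_closed dual_bases_expand(3)[OF field_K H.space bases] induced_right_comodule by blast
qed

end
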